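(* Let $n\ge2$ and let $\mathfrak g,V$ be $n$-Lie algebras. An $n$-Lie algebra $E$ factorizes extremely through $\mathfrak g$ and $V$ if and only if there is an extreme matched pair $(\rho_{\mathfrak g},\rho_V,\vartheta_V,\vartheta_{\mathfrak g})$ of $\mathfrak g$ and $V$ such that $E\cong\mathfrak g\bowtie V$ by an isomorphism which is the identity on both factors.
   Context: $K$ is a field of characteristic zero; vector spaces are over $K$, all maps are linear; a hat denotes omission. An $n$-Lie algebra is a vector space with an alternating $n$-linear bracket (an $n$-Lie bracket) satisfying $[z_1,\dots,z_{n-1},[w_1,\dots,w_n]]=\sum_{i=1}^n[w_1,\dots,w_{i-1},[z_1,\dots,z_{n-1},w_i],w_{i+1},\dots,w_n]$. $E$ factorizes extremely through $\mathfrak g$ and $V$ if $\mathfrak g,V\subseteq E$ are $n$-Lie subalgebras, $E=\mathfrak g\oplus V$ as vector spaces, and $[u_1,\dots,u_k,x_{k+1},\dots,x_n]_E=0$ for all $2\le k\le n-2$, $u_i\in V$, $x_j\in\mathfrak g$. An extreme matched pair is a quadruple of linear maps $\rho_{\mathfrak g}:\bigwedge^{n-1}\mathfrak g\to\mathrm{End}(V)$, $\rho_V:\bigwedge^{n-1}V\to\mathrm{End}(\mathfrak g)$, $\vartheta_V:V\to\mathrm{Hom}(\bigwedge^{n-1}\mathfrak g,\mathfrak g)$, $\vartheta_{\mathfrak g}:\mathfrak g\to\mathrm{Hom}(\bigwedge^{n-1}V,V)$ such that $$\begin{aligned}[x_1+u_1,\dots,x_n+u_n]_{\bowtie}={}&[x_1,\dots,x_n]_{\mathfrak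 g}+\sum_{i=1}^n(-1)^{i-1}\vartheta_V(u_i)(x_1,\dots,\widehat{x_i},\dots,x_n)+\sum_{i=1}^n(-1)^{n-i}\rho_V(u_1,\dots,\widehat{u_i},\dots,u_n)x_i\\&+[u_1,\dots,u_n]_V+\sum_{i=1}^n(-1)^{n-i}\rho_{\mathfrak g}(x_1,\dots,\widehat{x_i},\dots,x_n)u_i+\sum_{i=1}^n(-1)^{n-i}\vartheta_{\mathfrak g}(x_i)(u_1,\dots,\widehat{u_i},\dots,u_n)\end{aligned}$$ is an $n$-Lie bracket on $\mathfrak g\oplus V$; the resulting $n$-Lie algebra is $\mathfrak g\bowtie V$. *)

theory Defs
  imports "HOL-Algebra.Module" "HOL-Algebra.AbelCoset"
begin

locale char_zero_field = field K for K (structure) +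
  assumes char_zero: "\<And>m :: nat. 0 < m \<Longrightarrow> [m] \<cdot> \<one> \<noteq> \<zero>"


text \<open>Vector spaces over \<open>K\<close> are \<open>K\<close>-modules in the sense of the library. In a record of type
  module only carrier, zero, add and smult matter; mult and one are never used. An \<open>n\<close>-tuple is a
  list of length \<open>n\<close>; functions of several arguments are functions of lists, whose values on lists
  of any other length, or with entries outside the carrier, are irrelevant.\<close>

definition tuples :: "nat \<Rightarrow> ('v, 'a) partial_object_scheme \<Rightarrow> 'v list set" where
  "tuples k M = {xs. length xs = k \<and> set xs \<subseteq> carrier M}"

definition omit :: "nat \<Rightarrow> 'v list \<Rightarrow> 'v list" where
  "omit i xs = take i xs @ drop (Suc i) xs"

definition linear_map ::
  "('k, 'r) ring_scheme \<Rightarrow> ('k, 'v, 'a) module_scheme \<Rightarrow> ('k, 'w, 'b) module_scheme \<Rightarrow> ('v \<Rightarrow> 'w) \<Rightarrow> bool"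
where
  "linear_map K M N f \<longleftrightarrow>
     f \<in> hom (add_monoid M) (add_monoid N) \<and>
     (\<forall>a\<in>carrier K. \<forall>x\<in>carrier M. f (a \<odot>\<^bsub>M\<^esub> x) = a \<odot>\<^bsub>N\<^esub> f x)"

text \<open>By the universal property, these are the linear maps from the exterior power
  \<open>\<And>\<^sup>k M\<close> to \<open>N\<close>.\<close>

definition alternating_map ::
  "('k, 'r) ring_scheme \<Rightarrow> nat \<Rightarrow> ('k, 'v, 'a) module_scheme \<Rightarrow> ('k, 'w, 'b) module_scheme \<Rightarrow>
   ('v list \<Rightarrow> 'w) \<Rightarrow> bool"
where
  "alternating_map K k M N f \<longleftrightarrow>
     f \<in> tuples k M \<rightarrow> carrier N \<and>
     (\<forall>xs\<in>tuples k M. \<forall>i<k. linear_map K M N (\<lambda>x. f (xs[i := x]))) \<and>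
     (\<forall>xs\<in>tuples k M. \<forall>i j. i < j \<and> j < k \<and> xs ! i = xs ! j \<longrightarrow> f xs = \<zero>\<^bsub>N\<^esub>)"

text \<open>Linear maps \<open>\<And>\<^sup>k M \<rightarrow> Hom(N, P)\<close> and \<open>N \<rightarrow> Hom(\<And>\<^sup>k M, P)\<close>. The vector space operations of
  the target spaces are pointwise, so (alternating multi)linearity with values there can be tested
  pointwise.\<close>

definition alternating_map_to_Hom ::
  "('k, 'r) ring_scheme \<Rightarrow> nat \<Rightarrow> ('k, 'v, 'a) module_scheme \<Rightarrow> ('k, 'w, 'b) module_scheme \<Rightarrow>
   ('k, 'p, 'c) module_scheme \<Rightarrow> ('v list \<Rightarrow> 'w \<Rightarrow> 'p) \<Rightarrow> bool"
where
  "alternating_map_to_Hom K k M N P \<rho> \<longleftrightarrow>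
     (\<forall>xs\<in>tuples k M. linear_map K N P (\<rho> xs)) \<and>
     (\<forall>y\<in>carrier N. alternating_map K k M P (\<lambda>xs. \<rho> xs y))"

definition linear_map_to_alternating ::
  "('k, 'r) ring_scheme \<Rightarrow> ('k, 'w, 'b) module_scheme \<Rightarrow> nat \<Rightarrow> ('k, 'v, 'a) module_scheme \<Rightarrow>
   ('k, 'p, 'c) module_scheme \<Rightarrow> ('w \<Rightarrow> 'v list \<Rightarrow> 'p) \<Rightarrow> bool"
where
  "linear_map_to_alternating K N k M P \<theta> \<longleftrightarrow>
     (\<forall>y\<in>carrier N. alternating_map K k M P (\<theta> y)) \<and>
     (\<forall>xs\<in>tuples k M. linear_map K N P (\<lambda>y. \<theta> y xs))"

definition is_n_lie_bracket ::
  "('k, 'r) ring_scheme \<Rightarrow> nat \<Rightarrow> ('k, 'v, 'a) module_scheme \<Rightarrow> ('v list \<Rightarrow> 'v) \<Rightarrow> bool"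
where
  "is_n_lie_bracket K n M b \<longleftrightarrow>
     alternating_map K n M M b \<and>
     (\<forall>zs\<in>tuples (n - 1) M. \<forall>ws\<in>tuples n M.
        b (zs @ [b ws]) = (\<Oplus>\<^bsub>M\<^esub>i\<in>{..<n}. b (ws[i := b (zs @ [ws ! i])])))"

record ('k, 'v) n_lie = "('k, 'v) module" +
  bracket :: "'v list \<Rightarrow> 'v"

locale n_lie_algebra = char_zero_field K + module K L
  for K (structure) and n :: nat and L :: "('k, 'v, 'a) n_lie_scheme" (structure) +
  assumes n_lie_bracket: "is_n_lie_bracket K n L (bracket L)"

definition n_lie_subalgebra ::
  "('k, 'r) ring_scheme \<Rightarrow> nat \<Rightarrow> ('k, 'v, 'a) n_lie_scheme \<Rightarrow> ('k, 'v, 'b) n_lie_scheme \<Rightarrow> bool"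
where
  "n_lie_subalgebra K n H L \<longleftrightarrow>
     submodule (carrier H) K L \<and>
     (\<forall>xs\<in>tuples n H. bracket L xs \<in> carrier H) \<and>
     \<zero>\<^bsub>H\<^esub> = \<zero>\<^bsub>L\<^esub> \<and>
     (\<forall>x\<in>carrier H. \<forall>y\<in>carrier H. x \<oplus>\<^bsub>H\<^esub> y = x \<oplus>\<^bsub>L\<^esub> y) \<and>
     (\<forall>a\<in>carrier K. \<forall>x\<in>carrier H. a \<odot>\<^bsub>H\<^esub> x = a \<odot>\<^bsub>L\<^esub> x) \<and>
     (\<forall>xs\<in>tuples n H. bracket H xs = bracket L xs)"

definition factorizes_extremely ::
  "('k, 'r) ring_scheme \<Rightarrow> nat \<Rightarrow> ('k, 'v, 'c) n_lie_scheme \<Rightarrow>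
   ('k, 'v, 'a) n_lie_scheme \<Rightarrow> ('k, 'v, 'b) n_lie_scheme \<Rightarrow> bool"
where
  "factorizes_extremely K n E g V \<longleftrightarrow>
     n_lie_subalgebra K n g E \<and> n_lie_subalgebra K n V E \<and>
     carrier g <+>\<^bsub>E\<^esub> carrier V = carrier E \<and> carrier g \<inter> carrier V = {\<zero>\<^bsub>E\<^esub>} \<and>
     (\<forall>k. 2 \<le> k \<and> k + 2 \<le> n \<longrightarrow>
        (\<forall>us\<in>tuples k V. \<forall>xs\<in>tuples (n - k) g. bracket E (us @ xs) = \<zero>\<^bsub>E\<^esub>))"

definition direct_sum ::
  "('k, 'v, 'a) module_scheme \<Rightarrow> ('k, 'w, 'b) module_scheme \<Rightarrow> ('k, 'v \<times> 'w) module"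
where
  "direct_sum M N =
     \<lparr>carrier = carrier M \<times> carrier N,
      monoid.mult = undefined, one = undefined,
      zero = (\<zero>\<^bsub>M\<^esub>, \<zero>\<^bsub>N\<^esub>),
      add = (\<lambda>(x, u) (y, v). (x \<oplus>\<^bsub>M\<^esub> y, u \<oplus>\<^bsub>N\<^esub> v)),
      smult = (\<lambda>a (x, u). (a \<odot>\<^bsub>M\<^esub> x, a \<odot>\<^bsub>N\<^esub> u))\<rparr>"

text \<open>\<open>(-1)\<^sup>k x\<close>\<close>

definition signed ::
  "('k, 'r) ring_scheme \<Rightarrow> ('k, 'v, 'a) module_scheme \<Rightarrow> nat \<Rightarrow> 'v \<Rightarrow> 'v"
where
  "signed K M k x = ((\<ominus>\<^bsub>K\<^esub> \<one>\<^bsub>K\<^esub>) [^]\<^bsub>K\<^esub> k) \<odot>\<^bsub>M\<^esub> x"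

text \<open>Positions are counted from \<open>0\<close>: the usual exponents \<open>i - 1\<close> and \<open>n - i\<close> for
  \<open>i = 1, \<dots>, n\<close> become \<open>i\<close> and \<open>n - Suc i\<close>. The first component collects the summands with values
  in \<open>g\<close>, the second one those with values in \<open>V\<close>.\<close>

definition bowtie_bracket ::
  "('k, 'r) ring_scheme \<Rightarrow> nat \<Rightarrow> ('k, 'v, 'a) n_lie_scheme \<Rightarrow> ('k, 'w, 'b) n_lie_scheme \<Rightarrow>
   ('v list \<Rightarrow> 'w \<Rightarrow> 'w) \<Rightarrow> ('w list \<Rightarrow> 'v \<Rightarrow> 'v) \<Rightarrow> ('w \<Rightarrow> 'v list \<Rightarrow> 'v) \<Rightarrow> ('v \<Rightarrow> 'w list \<Rightarrow> 'w) \<Rightarrow>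
   ('v \<times> 'w) list \<Rightarrow> 'v \<times> 'w"
where
  "bowtie_bracket K n g V \<rho>\<^sub>g \<rho>\<^sub>V \<theta>\<^sub>V \<theta>\<^sub>g ps =
     (let xs = map fst ps; us = map snd ps in
       (bracket g xs
          \<oplus>\<^bsub>g\<^esub> (\<Oplus>\<^bsub>g\<^esub>i\<in>{..<n}. signed K g i (\<theta>\<^sub>V (us ! i) (omit i xs)))
          \<oplus>\<^bsub>g\<^esub> (\<Oplus>\<^bsub>g\<^esub>i\<in>{..<n}. signed K g (n - Suc i) (\<rho>\<^sub>V (omit i us) (xs ! i))),
        bracket V us
          \<oplus>\<^bsub>V\<^esub> (\<Oplus>\<^bsub>V\<^esub>i\<in>{..<n}. signed K V (n - Suc i) (\<rho>\<^sub>g (omit i xs) (us ! i)))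
          \<oplus>\<^bsub>V\<^esub> (\<Oplus>\<^bsub>V\<^esub>i\<in>{..<n}. signed K V (n - Suc i) (\<theta>\<^sub>g (xs ! i) (omit i us)))))"

definition extreme_matched_pair ::
  "('k, 'r) ring_scheme \<Rightarrow> nat \<Rightarrow> ('k, 'v, 'a) n_lie_scheme \<Rightarrow> ('k, 'w, 'b) n_lie_scheme \<Rightarrow>
   ('v list \<Rightarrow> 'w \<Rightarrow> 'w) \<Rightarrow> ('w list \<Rightarrow> 'v \<Rightarrow> 'v) \<Rightarrow> ('w \<Rightarrow> 'v list \<Rightarrow> 'v) \<Rightarrow> ('v \<Rightarrow> 'w list \<Rightarrow> 'w) \<Rightarrow> bool"
where
  "extreme_matched_pair K n g V \<rho>\<^sub>g \<rho>\<^sub>V \<theta>\<^sub>V \<theta>\<^sub>g \<longleftrightarrow>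
     alternating_map_to_Hom K (n - 1) g V V \<rho>\<^sub>g \<and>
     alternating_map_to_Hom K (n - 1) V g g \<rho>\<^sub>V \<and>
     linear_map_to_alternating K V (n - 1) g g \<theta>\<^sub>V \<and>
     linear_map_to_alternating K g (n - 1) V V \<theta>\<^sub>g \<and>
     is_n_lie_bracket K n (direct_sum g V) (bowtie_bracket K n g V \<rho>\<^sub>g \<rho>\<^sub>V \<theta>\<^sub>V \<theta>\<^sub>g)"

definition bowtie ::
  "('k, 'r) ring_scheme \<Rightarrow> nat \<Rightarrow> ('k, 'v, 'a) n_lie_scheme \<Rightarrow> ('k, 'w, 'b) n_lie_scheme \<Rightarrow>
   ('v list \<Rightarrow> 'w \<Rightarrow> 'w) \<Rightarrow> ('w list \<Rightarrow> 'v \<Rightarrow> 'v) \<Rightarrow> ('w \<Rightarrow> 'v list \<Rightarrow> 'v) \<Rightarrow> ('v \<Rightarrow> 'w list \<Rightarrow> 'w) \<Rightarrow>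
   ('k, 'v \<times> 'w) n_lie"
where
  "bowtie K n g V \<rho>\<^sub>g \<rho>\<^sub>V \<theta>\<^sub>V \<theta>\<^sub>g =
     module.extend (direct_sum g V) \<lparr>bracket = bowtie_bracket K n g V \<rho>\<^sub>g \<rho>\<^sub>V \<theta>\<^sub>V \<theta>\<^sub>g\<rparr>"

definition n_lie_iso ::
  "('k, 'r) ring_scheme \<Rightarrow> nat \<Rightarrow> ('k, 'v, 'a) n_lie_scheme \<Rightarrow> ('k, 'w, 'b) n_lie_scheme \<Rightarrow>
   ('v \<Rightarrow> 'w) set"
where
  "n_lie_iso K n L L' =
     {\<phi>. linear_map K L L' \<phi> \<and> bij_betw \<phi> (carrier L) (carrier L') \<and>
         (\<forall>xs\<in>tuples n L. \<phi> (bracket L xs) = bracket L' (map \<phi> xs))}"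

lemma direct_sum_module:
  assumes "module K M" "module K N"
  shows "module K (direct_sum M N)"
proof -
  interpret M: module K M by fact
  interpret N: module K N by fact
  show ?thesis
  proof (rule moduleI)
    show "cring K" by (rule M.R.cring_axioms)
    show "abelian_group (direct_sum M N)"
    proof (rule abelian_groupI)
      fix p assume "p \<in> carrier (direct_sum M N)"
      then show "\<exists>q\<in>carrier (direct_sum M N). q \<oplus>\<^bsub>direct_sum M N\<^esub> p = \<zero>\<^bsub>direct_sum M N\<^esub>"
        by (intro bexI[of _ "(\<ominus>\<^bsub>M\<^esub> fst p, \<ominus>\<^bsub>N\<^esub> snd p)"])
          (auto simp: direct_sum_def M.l_neg N.l_neg)
    qed (auto simp: direct_sum_def M.a_ac N.a_ac)
  qed (auto simp: direct_sum_def M.smult_l_distr N.smult_l_distr M.smult_r_distr N.smult_r_distr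
      M.smult_assoc1 N.smult_assoc1)
qed

lemma bowtie_n_lie_algebra:
  assumes "n_lie_algebra K n g" "n_lie_algebra K n V" "extreme_matched_pair K n g V \<rho>\<^sub>g \<rho>\<^sub>V \<theta>\<^sub>V \<theta>\<^sub>g"
  shows "n_lie_algebra K n (bowtie K n g V \<rho>\<^sub>g \<rho>\<^sub>V \<theta>\<^sub>V \<theta>\<^sub>g)"
proof -
  let ?D = "direct_sum g V" and ?B = "bowtie K n g V \<rho>\<^sub>g \<rho>\<^sub>V \<theta>\<^sub>V \<theta>\<^sub>g"
  interpret g: n_lie_algebra K n g by fact
  interpret V: n_lie_algebra K n V by fact
  interpret D: module K ?D by (rule direct_sum_module) unfold_locales
  have eq: "carrier ?B = carrier ?D" "add ?B = add ?D" "zero ?B = zero ?D" "smult ?B = smult ?D"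
    "bracket ?B = bowtie_bracket K n g V \<rho>\<^sub>g \<rho>\<^sub>V \<theta>\<^sub>V \<theta>\<^sub>g"
    by (simp_all add: bowtie_def module.defs)
  have mod: "module K ?B"
  proof (rule moduleI)
    show "cring K" using D.module_axioms by (simp add: module_def)
    show "abelian_group ?B"
      by (rule abelian_groupI)
        (auto simp: eq D.M.a_ac intro: D.M.l_neg)
  qed (auto simp: eq D.smult_l_distr D.smult_r_distr D.smult_assoc1)
  have "is_n_lie_bracket K n ?D (bowtie_bracket K n g V \<rho>\<^sub>g \<rho>\<^sub>V \<theta>\<^sub>V \<theta>\<^sub>g)"
    using assms(3) by (simp add: extreme_matched_pair_def)
  then have "is_n_lie_bracket K n ?B (bracket ?B)"
    by (simp add: is_n_lie_bracket_def alternating_map_def linear_map_def tuples_def finsum_def finprod_def hom_def eq)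
  then show ?thesis
    using mod g.char_zero_field_axioms by (simp add: n_lie_algebra_def n_lie_algebra_axioms_def)
qed

end

theory Submission
  imports Defs "HOL-Library.Multiset"
begin

text \<open>If \<open>E\<close> is the direct sum of \<open>g\<close> and \<open>V\<close>, then \<open>(x, u) \<mapsto> x + u\<close> is a bijection \<open>g \<oplus> V \<rightarrow> E\<close>,
  and the only question is which brackets on \<open>g \<oplus> V\<close> arise by pulling back the bracket of \<open>E\<close>. By
  multilinearity, \<open>[x\<^sub>1 + u\<^sub>1, \<dots>, x\<^sub>n + u\<^sub>n]\<close> is the sum over all sets \<open>S\<close> of slots of the bracket
  that has \<open>u\<^sub>i\<close> in the slots in \<open>S\<close> and \<open>x\<^sub>i\<close> in the others (\<open>expand_sum\<close>). The factorization is
  extreme when the summands with \<open>2 \<le> |S| \<le> n - 2\<close> vanish: up to sign, each can be reordered so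
  that the entries in \<open>V\<close> come first (\<open>zero_permute\<close>). What remains is \<open>|S| = 0\<close> and \<open>|S| = n\<close>, the
  brackets of the subalgebras, and \<open>|S| = 1\<close> and \<open>|S| = n - 1\<close>. Moving the one exceptional entry to
  the end or to the front (\<open>move\<close>) gives the signs in the bracket of \<open>g \<bowtie> V\<close>, and splitting the values
  into their components in \<open>g\<close> and \<open>V\<close> gives the four maps of the matched pair. That they form a
  matched pair requires the bracket of \<open>g \<bowtie> V\<close> to be an \<open>n\<close>-Lie bracket, which holds because it is
  that of \<open>E\<close> pulled back along a linear isomorphism (\<open>n_lie_bracket_transport\<close>).

  For \<open>n = 2\<close> the cases \<open>|S| = 1\<close> and \<open>|S| = n - 1\<close> are the same; there \<open>\<theta>\<^sub>V\<close> and \<open>\<theta>\<^sub>g\<close> are taken to be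
  zero and \<open>\<rho>\<^sub>V\<close> and \<open>\<rho>\<^sub>g\<close> carry everything.

  Conversely, in \<open>g \<bowtie> V\<close> both factors are subalgebras and mixed brackets with at least two entries
  in each factor vanish, because in these cases every mixed summand has a zero among its
  arguments (\<open>bowtie_bracket_no_mixed_terms\<close>).\<close>

section \<open>Signs and linear maps\<close>

context module
begin

lemma signed_closed [simp, intro]: "x \<in> carrier M \<Longrightarrow> signed R M k x \<in> carrier M"
  by (simp add: signed_def)

lemma signed_0 [simp]: "x \<in> carrier M \<Longrightarrow> signed R M 0 x = x"
  by (simp add: signed_def)

lemma signed_zero [simp]: "signed R M k \<zero>\<^bsub>M\<^esub> = \<zero>\<^bsub>M\<^esub>"
  by (simp add: signed_def)

lemma signed_Suc: "x \<in> carrier M \<Longrightarrow> signed R M (Suc k) x = \<ominus>\<^bsub>M\<^esub> signed R M k x"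
  by (simp add: signed_def R.r_minus smult_l_minus)

lemma signed_minus: "x \<in> carrier M \<Longrightarrow> signed R M k (\<ominus>\<^bsub>M\<^esub> x) = \<ominus>\<^bsub>M\<^esub> signed R M k x"
  by (simp add: signed_def smult_r_minus)

lemma signed_signed: "x \<in> carrier M \<Longrightarrow> signed R M k (signed R M k x) = x"
  by (induction k) (simp_all add: signed_Suc signed_minus)

end

lemma linear_map_closed: "linear_map K M N f \<Longrightarrow> x \<in> carrier M \<Longrightarrow> f x \<in> carrier N"
  by (auto simp: linear_map_def hom_def)

lemma linear_map_add:
  "linear_map K M N f \<Longrightarrow> x \<in> carrier M \<Longrightarrow> y \<in> carrier M \<Longrightarrow> f (x \<oplus>\<^bsub>M\<^esub> y) = f x \<oplus>\<^bsub>N\<^esub> f y"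
  by (auto simp: linear_map_def hom_def)

lemma linear_map_smult:
  "linear_map K M N f \<Longrightarrow> a \<in> carrier K \<Longrightarrow> x \<in> carrier M \<Longrightarrow> f (a \<odot>\<^bsub>M\<^esub> x) = a \<odot>\<^bsub>N\<^esub> f x"
  by (auto simp: linear_map_def)

lemma linear_mapI:
  assumes "\<And>x. x \<in> carrier M \<Longrightarrow> f x \<in> carrier N"
    and "\<And>x y. x \<in> carrier M \<Longrightarrow> y \<in> carrier M \<Longrightarrow> f (x \<oplus>\<^bsub>M\<^esub> y) = f x \<oplus>\<^bsub>N\<^esub> f y"
    and "\<And>a x. a \<in> carrier K \<Longrightarrow> x \<in> carrier M \<Longrightarrow> f (a \<odot>\<^bsub>M\<^esub> x) = a \<odot>\<^bsub>N\<^esub> f x"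
  shows "linear_map K M N f"
  using assms by (auto simp: linear_map_def hom_def)

lemma linear_map_compose:
  assumes "linear_map K M N f" "linear_map K N P h"
  shows "linear_map K M P (\<lambda>x. h (f x))"
  using assms by (intro linear_mapI)
    (simp_all add: linear_map_closed linear_map_add linear_map_smult)

lemma linear_map_cong:
  assumes "linear_map K M N f" "module K M" "\<And>x. x \<in> carrier M \<Longrightarrow> f x = h x"
  shows "linear_map K M N h"
proof -
  interpret M: module K M by fact
  show ?thesis
    by (rule linear_mapI) (simp_all add: assms(3)[symmetric]
        linear_map_closed[OF assms(1)] linear_map_add[OF assms(1)] linear_map_smult[OF assms(1)])
qed

lemma linear_map_const_zero:
  assumes "module K N"
  shows "linear_map K M N (\<lambda>_. \<zero>\<^bsub>N\<^esub>)"
proof -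
  interpret N: module K N by fact
  show ?thesis by (rule linear_mapI) simp_all
qed

lemma linear_map_zero:
  assumes "module K M" "module K N" "linear_map K M N f"
  shows "f \<zero>\<^bsub>M\<^esub> = \<zero>\<^bsub>N\<^esub>"
proof -
  interpret M: module K M by fact
  interpret N: module K N by fact
  have "f \<zero>\<^bsub>M\<^esub> \<oplus>\<^bsub>N\<^esub> f \<zero>\<^bsub>M\<^esub> = f \<zero>\<^bsub>M\<^esub>"
    using linear_map_add[OF assms(3), of "\<zero>\<^bsub>M\<^esub>" "\<zero>\<^bsub>M\<^esub>"] by simp
  then show ?thesis
    using linear_map_closed[OF assms(3) M.zero_closed] by (metis N.add.r_cancel_one)
qed

lemma linear_map_finsum:
  assumes "module K M" "module K N" "linear_map K M N f"
    and "finite A" "h \<in> A \<rightarrow> carrier M"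
  shows "f (\<Oplus>\<^bsub>M\<^esub>i\<in>A. h i) = (\<Oplus>\<^bsub>N\<^esub>i\<in>A. f (h i))"
proof -
  interpret M: module K M by fact
  interpret N: module K N by fact
  show ?thesis
    using assms(4,5)
  proof (induction A rule: finite_induct)
    case empty
    then show ?case by (simp add: linear_map_zero[OF assms(1-3)])
  next
    case (insert a A)
    then have "(\<lambda>i. f (h i)) \<in> A \<rightarrow> carrier N" "f (h a) \<in> carrier N"
      using linear_map_closed[OF assms(3)] by auto
    with insert show ?case by (simp add: linear_map_add[OF assms(3)])
  qed
qed

lemma linear_map_inv_into:
  assumes "module K M" "linear_map K M N f" "bij_betw f (carrier M) (carrier N)"
  shows "linear_map K N M (inv_into (carrier M) f)"
proof -
  interpret M: module K M by fact
  let ?h = "inv_into (carrier M) f"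
  have closed: "?h y \<in> carrier M" and f_h: "f (?h y) = y" if "y \<in> carrier N" for y
    using assms(3) that by (auto simp: bij_betw_def inv_into_into f_inv_into_f)
  have h_f: "?h (f x) = x" if "x \<in> carrier M" for x
    using assms(3) that by (auto simp: bij_betw_def)
  show ?thesis
  proof (rule linear_mapI)
    fix x y assume xy: "x \<in> carrier N" "y \<in> carrier N"
    have "?h (f (?h x \<oplus>\<^bsub>M\<^esub> ?h y)) = ?h x \<oplus>\<^bsub>M\<^esub> ?h y"
      using xy by (intro h_f M.a_closed closed)
    then show "?h (x \<oplus>\<^bsub>N\<^esub> y) = ?h x \<oplus>\<^bsub>M\<^esub> ?h y"
      using xy by (simp add: linear_map_add[OF assms(2)] closed f_h)
  next
    fix a x assume ax: "a \<in> carrier K" "x \<in> carrier N"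
    have "?h (f (a \<odot>\<^bsub>M\<^esub> ?h x)) = a \<odot>\<^bsub>M\<^esub> ?h x"
      using ax by (intro h_f M.smult_closed closed)
    then show "?h (a \<odot>\<^bsub>N\<^esub> x) = a \<odot>\<^bsub>M\<^esub> ?h x"
      using ax by (simp add: linear_map_smult[OF assms(2)] closed f_h)
  qed (rule closed)
qed

section \<open>Alternating maps\<close>

lemma alternating_map_linear:
  "alternating_map K k M N f \<Longrightarrow> xs \<in> tuples k M \<Longrightarrow> i < k \<Longrightarrow> linear_map K M N (\<lambda>x. f (xs[i := x]))"
  by (simp add: alternating_map_def)

lemma alternating_map_const_zero:
  assumes "module K N"
  shows "alternating_map K k M N (\<lambda>_. \<zero>\<^bsub>N\<^esub>)"
  using module.axioms(2)[OF assms]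
  by (auto simp: alternating_map_def abelian_groupE(2) intro: linear_map_const_zero[OF assms])

lemma alternating_map_compose:
  assumes "alternating_map K k M N f" "linear_map K N P h" "module K N" "module K P"
  shows "alternating_map K k M P (\<lambda>xs. h (f xs))"
  unfolding alternating_map_def
proof (intro conjI ballI allI impI)
  show "(\<lambda>xs. h (f xs)) \<in> tuples k M \<rightarrow> carrier P"
    using assms(1) linear_map_closed[OF assms(2)] by (auto simp: alternating_map_def)
  show "linear_map K M P (\<lambda>x. h (f (xs[i := x])))" if "xs \<in> tuples k M" "i < k" for xs i
    by (rule linear_map_compose[OF alternating_map_linear[OF assms(1) that] assms(2)])
qed (use assms(1) linear_map_zero[OF assms(3,4,2)] in \<open>auto simp: alternating_map_def\<close>)

lemma update_in_tuples: "xs \<in> tuples k M \<Longrightarrow> x \<in> carrier M \<Longrightarrow> xs[i := x] \<in> tuples k M"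
  using set_update_subset_insert[of xs i x] by (auto simp: tuples_def)

text \<open>With the inclusion of a subspace as \<open>h\<close> this restricts an alternating map to the subspace.
  Since a subspace is a record of its own, with its own operations, the linearity of the inclusion
  is exactly what says that the two structures agree.\<close>

lemma alternating_map_precompose:
  assumes "alternating_map K k M N f" "linear_map K H M h"
  shows "alternating_map K k H N (\<lambda>xs. f (map h xs))"
  unfolding alternating_map_def
proof (intro conjI ballI allI impI)
  have tup: "map h xs \<in> tuples k M" if "xs \<in> tuples k H" for xs
    using that linear_map_closed[OF assms(2)] by (auto simp: tuples_def)
  show "(\<lambda>xs. f (map h xs)) \<in> tuples k H \<rightarrow> carrier N"
    using assms(1) tup by (auto simp: alternating_map_def)
  fix xs assume xs: "xs \<in> tuples k H"
  show "linear_map K H N (\<lambda>x. f (map h (xs[i := x])))" if "i < k" for i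
    unfolding map_update
    by (rule linear_map_compose[OF assms(2) alternating_map_linear[OF assms(1) tup[OF xs] that]])
  show "f (map h xs) = \<zero>\<^bsub>N\<^esub>" if "i < j \<and> j < k \<and> xs ! i = xs ! j" for i j
  proof -
    have "i < j" "j < k" "map h xs ! i = map h xs ! j"
      using that xs by (auto simp: tuples_def)
    then show ?thesis
      using assms(1) tup[OF xs] unfolding alternating_map_def by blast
  qed
qed

lemma alternating_map_snoc:
  assumes "alternating_map K (Suc k) M N f" "y \<in> carrier M"
  shows "alternating_map K k M N (\<lambda>xs. f (xs @ [y]))"
  unfolding alternating_map_def
proof (intro conjI ballI allI impI)
  have snoc: "xs @ [y] \<in> tuples (Suc k) M" if "xs \<in> tuples k M" for xs
    using that assms(2) by (auto simp: tuples_def)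
  show "(\<lambda>xs. f (xs @ [y])) \<in> tuples k M \<rightarrow> carrier N"
    using assms(1) snoc by (auto simp: alternating_map_def)
  fix xs assume xs: "xs \<in> tuples k M"
  then have len: "length xs = k" by (simp add: tuples_def)
  show "linear_map K M N (\<lambda>x. f (xs[i := x] @ [y]))" if "i < k" for i
    using alternating_map_linear[OF assms(1) snoc[OF xs], of i] that len
    by (simp add: list_update_append)
  show "f (xs @ [y]) = \<zero>\<^bsub>N\<^esub>" if "i < j \<and> j < k \<and> xs ! i = xs ! j" for i j
  proof -
    have "i < j" "j < Suc k" "(xs @ [y]) ! i = (xs @ [y]) ! j"
      using that len by (auto simp: nth_append)
    then show ?thesis
      using assms(1) snoc[OF xs] unfolding alternating_map_def by blast
  qed
qed

lemma alternating_map_Cons: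
  assumes "alternating_map K (Suc k) M N f" "y \<in> carrier M"
  shows "alternating_map K k M N (\<lambda>xs. f (y # xs))"
  unfolding alternating_map_def
proof (intro conjI ballI allI impI)
  have cons: "y # xs \<in> tuples (Suc k) M" if "xs \<in> tuples k M" for xs
    using that assms(2) by (auto simp: tuples_def)
  show "(\<lambda>xs. f (y # xs)) \<in> tuples k M \<rightarrow> carrier N"
    using assms(1) cons by (auto simp: alternating_map_def)
  fix xs assume xs: "xs \<in> tuples k M"
  show "linear_map K M N (\<lambda>x. f (y # xs[i := x]))" if "i < k" for i
    using alternating_map_linear[OF assms(1) cons[OF xs], of "Suc i"] that by simp
  show "f (y # xs) = \<zero>\<^bsub>N\<^esub>" if "i < j \<and> j < k \<and> xs ! i = xs ! j" for i j
  proof -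
    have "Suc i < Suc j" "Suc j < Suc k" "(y # xs) ! Suc i = (y # xs) ! Suc j"
      using that by auto
    then show ?thesis
      using assms(1) cons[OF xs] unfolding alternating_map_def by blast
  qed
qed

section \<open>Permuting and adding the arguments of an alternating map\<close>

definition mix :: "nat set \<Rightarrow> 'v list \<Rightarrow> 'v list \<Rightarrow> 'v list" where
  "mix S xs us = map (\<lambda>j. if j \<in> S then us ! j else xs ! j) [0..<length xs]"

lemma mix_singleton: "mix {i} xs us = xs[i := us ! i]"
  by (rule nth_equalityI) (auto simp: mix_def nth_list_update)

lemma mix_co_singleton:
  "length us = length xs \<Longrightarrow> mix ({..<length xs} - {i}) xs us = us[i := xs ! i]"
  by (rule nth_equalityI) (auto simp: mix_def nth_list_update)

locale alternating = M: module K M + N: module K N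
  for K (structure) and M and N +
  fixes n :: nat and f
  assumes alternating_map: "alternating_map K n M N f"
begin

lemma closed: "xs \<in> tuples n M \<Longrightarrow> f xs \<in> carrier N"
  using alternating_map by (auto simp: alternating_map_def)

lemma eq_entries:
  "xs \<in> tuples n M \<Longrightarrow> i < j \<Longrightarrow> j < n \<Longrightarrow> xs ! i = xs ! j \<Longrightarrow> f xs = \<zero>\<^bsub>N\<^esub>"
  using alternating_map by (auto simp: alternating_map_def)

lemma update_add:
  assumes "xs \<in> tuples n M" "i < n" "x \<in> carrier M" "y \<in> carrier M"
  shows "f (xs[i := x \<oplus>\<^bsub>M\<^esub> y]) = f (xs[i := x]) \<oplus>\<^bsub>N\<^esub> f (xs[i := y])"
  using linear_map_add[OF alternating_map_linear[OF alternating_map]] assms by fast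

lemma zero_entry:
  assumes "xs \<in> tuples n M" "\<zero>\<^bsub>M\<^esub> \<in> set xs"
  shows "f xs = \<zero>\<^bsub>N\<^esub>"
proof -
  from assms obtain i where "i < n" "xs ! i = \<zero>\<^bsub>M\<^esub>"
    by (auto simp: tuples_def in_set_conv_nth)
  then show ?thesis
    using linear_map_zero[OF M.module_axioms N.module_axioms
        alternating_map_linear[OF alternating_map assms(1), of i]]
    by (metis list_update_id)
qed

text \<open>Polarization: expand \<open>f (\<dots>, a + b, a + b, \<dots>) = 0\<close>.\<close>

lemma swap_adjacent:
  assumes "p @ a # b # q \<in> tuples n M"
  shows "f (p @ a # b # q) = \<ominus>\<^bsub>N\<^esub> f (p @ b # a # q)"
proof -
  let ?g = "\<lambda>x y. f (p @ x # y # q)" and ?k = "length p"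
  have a: "a \<in> carrier M" and b: "b \<in> carrier M"
    and tup: "\<And>x y. x \<in> carrier M \<Longrightarrow> y \<in> carrier M \<Longrightarrow> p @ x # y # q \<in> tuples n M"
    and k: "Suc ?k < n"
    using assms by (auto simp: tuples_def)
  have left: "?g (x \<oplus>\<^bsub>M\<^esub> y) z = ?g x z \<oplus>\<^bsub>N\<^esub> ?g y z"
    and right: "?g z (x \<oplus>\<^bsub>M\<^esub> y) = ?g z x \<oplus>\<^bsub>N\<^esub> ?g z y"
    if "x \<in> carrier M" "y \<in> carrier M" "z \<in> carrier M" for x y z
    using update_add[OF tup[OF that(1,3)], of ?k x y] update_add[OF tup[OF that(3,1)], of "Suc ?k" x y]
      that k by (simp_all add: list_update_append)
  have same: "?g x x = \<zero>\<^bsub>N\<^esub>" if "x \<in> carrier M" for x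
    using eq_entries[OF tup[OF that that], of ?k "Suc ?k"] k by (simp add: nth_append)
  have "\<zero>\<^bsub>N\<^esub> = ?g (a \<oplus>\<^bsub>M\<^esub> b) (a \<oplus>\<^bsub>M\<^esub> b)"
    using a b by (simp add: same)
  also have "\<dots> = ?g a (a \<oplus>\<^bsub>M\<^esub> b) \<oplus>\<^bsub>N\<^esub> ?g b (a \<oplus>\<^bsub>M\<^esub> b)"
    using a b by (intro left) simp_all
  also have "\<dots> = ?g a b \<oplus>\<^bsub>N\<^esub> ?g b a"
    using a b by (simp add: right same closed tup)
  finally have "?g a b \<oplus>\<^bsub>N\<^esub> ?g b a = \<zero>\<^bsub>N\<^esub>" ..
  then show ?thesis
    using a b by (intro N.minus_equality[symmetric]) (simp_all add: closed tup)
qed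

text \<open>Carrying \<open>a\<close> to the left past the entries of \<open>q\<close> takes \<open>length q\<close> adjacent swaps. This is the
  source of all signs in the bracket of \<open>g \<bowtie> V\<close>.\<close>

lemma move:
  assumes "p @ q @ a # r \<in> tuples n M"
  shows "f (p @ q @ a # r) = signed K N (length q) (f (p @ a # q @ r))"
  using assms
proof (induction q arbitrary: r rule: rev_induct)
  case Nil
  then show ?case by (simp add: closed)
next
  case (snoc b q)
  then have 1: "p @ q @ a # b # r \<in> tuples n M" and 2: "p @ a # q @ b # r \<in> tuples n M"
    by (auto simp: tuples_def)
  have "f (p @ (q @ [b]) @ a # r) = \<ominus>\<^bsub>N\<^esub> f (p @ q @ a # b # r)"
    using swap_adjacent[of "p @ q" b a r] snoc.prems by simp
  also have "\<dots> = \<ominus>\<^bsub>N\<^esub> signed K N (length q) (f (p @ a # q @ b # r))"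
    using snoc.IH[OF 1] by simp
  finally show ?case
    using 2 by (simp add: N.signed_Suc closed)
qed

lemma update_eq_Cons_omit:
  assumes "xs \<in> tuples n M" "y \<in> carrier M" "i < n"
  shows "f (xs[i := y]) = signed K N i (f (y # omit i xs))"
proof -
  have upd: "xs[i := y] = take i xs @ y # drop (Suc i) xs" and len: "length (take i xs) = i"
    using assms by (simp_all add: upd_conv_take_nth_drop tuples_def)
  show ?thesis
    using move[of "[]" "take i xs" y "drop (Suc i) xs"] update_in_tuples[OF assms(1,2), of i]
    unfolding upd len omit_def by simp
qed

lemma update_eq_omit_snoc:
  assumes "xs \<in> tuples n M" "y \<in> carrier M" "i < n"
  shows "f (xs[i := y]) = signed K N (n - Suc i) (f (omit i xs @ [y]))"
proof -
  have upd: "xs[i := y] = take i xs @ y # drop (Suc i) xs" and len: "length xs = n"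
    using assms by (simp_all add: upd_conv_take_nth_drop tuples_def)
  have tup: "xs[i := y] \<in> tuples n M" "take i xs @ drop (Suc i) xs @ [y] \<in> tuples n M"
    using assms update_in_tuples[OF assms(1,2), of i]
    by (auto simp: tuples_def dest: in_set_takeD in_set_dropD)
  then have "f (omit i xs @ [y]) = signed K N (n - Suc i) (f (xs[i := y]))"
    using move[of "take i xs" "drop (Suc i) xs" y "[]"] len by (simp add: omit_def upd)
  then show ?thesis
    using closed[OF tup(1)] by (simp add: N.signed_signed)
qed

text \<open>A permutation moves the entries to their places one at a time, which changes only the sign,
  so vanishing does not depend on the order of the entries. The fixed prefix \<open>p\<close> holds the
  entries that the induction has already put in place.\<close>

lemma zero_permute:
  assumes "p @ xs \<in> tuples n M" "mset xs = mset ys" "f (p @ ys) = \<zero>\<^bsub>N\<^esub>"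
  shows "f (p @ xs) = \<zero>\<^bsub>N\<^esub>"
  using assms
proof (induction xs arbitrary: p ys)
  case Nil
  from Nil.prems(2) have "ys = []"
    by simp
  with Nil show ?case by simp
next
  case (Cons a xs)
  then have "a \<in> set ys"
    by (metis list.set_intros(1) mset_eq_setD)
  then obtain q r where ys: "ys = q @ a # r"
    by (meson split_list)
  have set: "set (a # xs) = set ys"
    using Cons.prems(2) by (rule mset_eq_setD)
  moreover have len: "length (a # xs) = length ys"
    using Cons.prems(2) by (rule mset_eq_length)
  ultimately have 1: "p @ q @ a # r \<in> tuples n M" "p @ a # q @ r \<in> tuples n M"
    using Cons.prems(1) by (auto simp: tuples_def ys)
  have "f (p @ a # q @ r) = signed K N (length q) (signed K N (length q) (f (p @ a # q @ r)))"
    by (simp add: N.signed_signed closed[OF 1(2)])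
  also have "\<dots> = signed K N (length q) (f (p @ ys))"
    using move[OF 1(1)] by (simp add: ys)
  also have "\<dots> = \<zero>\<^bsub>N\<^esub>"
    using Cons.prems(3) by simp
  finally show ?case
    using Cons.IH[of "p @ [a]" "q @ r"] Cons.prems(1,2) by (simp add: ys)
qed

text \<open>Multilinearity, one slot after the other: \<open>f (x\<^sub>1 + u\<^sub>1, \<dots>, x\<^sub>n + u\<^sub>n)\<close> has one summand for each
  set \<open>S\<close> of slots from which the \<open>u\<close>-entry is taken.\<close>

lemma expand_sum:
  assumes "xs \<in> tuples n M" "us \<in> tuples n M"
  shows "f (map2 (\<oplus>\<^bsub>M\<^esub>) xs us) = (\<Oplus>\<^bsub>N\<^esub>S\<in>Pow {..<n}. f (mix S xs us))"
proof -
  \<comment> \<open>the slots below \<open>m\<close> are already split, those from \<open>m\<close> on still hold the sums\<close>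
  define h where
    "h m S = map (\<lambda>j. if m \<le> j then xs ! j \<oplus>\<^bsub>M\<^esub> us ! j else if j \<in> S then us ! j else xs ! j) [0..<n]"
    for m S
  have len: "length xs = n" "length us = n"
    and entries: "\<And>j. j < n \<Longrightarrow> xs ! j \<in> carrier M" "\<And>j. j < n \<Longrightarrow> us ! j \<in> carrier M"
    using assms by (auto simp: tuples_def subset_iff)
  have tup: "h m S \<in> tuples n M" for m S
    by (auto simp: h_def tuples_def entries)
  have split: "f (h m S) = f (h (Suc m) S) \<oplus>\<^bsub>N\<^esub> f (h (Suc m) (insert m S))"
    if "m < n" "m \<notin> S" for m S
  proof -
    have "h m S = (h m S)[m := xs ! m \<oplus>\<^bsub>M\<^esub> us ! m]"
      "h (Suc m) S = (h m S)[m := xs ! m]" "h (Suc m) (insert m S) = (h m S)[m := us ! m]"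
      using that by (auto simp: h_def nth_list_update intro!: nth_equalityI)
    then show ?thesis
      using update_add[OF tup, of m "xs ! m" "us ! m" m S] that entries by simp
  qed
  have "f (h 0 {}) = (\<Oplus>\<^bsub>N\<^esub>S\<in>Pow {..<m}. f (h m S))" if "m \<le> n" for m
    using that
  proof (induction m)
    case 0
    then show ?case by (simp add: closed tup)
  next
    case (Suc m)
    have inj: "inj_on (insert m) (Pow {..<m})"
      by (rule inj_on_inverseI[of _ "\<lambda>S. S - {m}"]) auto
    have Pow: "Pow {..<Suc m} = Pow {..<m} \<union> insert m ` Pow {..<m}"
      by (simp add: lessThan_Suc Pow_insert)
    have "f (h 0 {}) = (\<Oplus>\<^bsub>N\<^esub>S\<in>Pow {..<m}. f (h m S))"
      using Suc by simp
    also have "\<dots> = (\<Oplus>\<^bsub>N\<^esub>S\<in>Pow {..<m}. f (h (Suc m) S) \<oplus>\<^bsub>N\<^esub> f (h (Suc m) (insert m S)))"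
      using Suc.prems by (intro N.add.finprod_cong') (auto intro!: split closed tup)
    also have "\<dots> = (\<Oplus>\<^bsub>N\<^esub>S\<in>Pow {..<m}. f (h (Suc m) S)) \<oplus>\<^bsub>N\<^esub>
        (\<Oplus>\<^bsub>N\<^esub>S\<in>insert m ` Pow {..<m}. f (h (Suc m) S))"
      using inj by (subst N.finsum_reindex) (auto simp: N.finsum_addf closed tup)
    also have "\<dots> = (\<Oplus>\<^bsub>N\<^esub>S\<in>Pow {..<Suc m}. f (h (Suc m) S))"
      unfolding Pow by (subst N.finsum_Un_disjoint) (auto simp: closed tup)
    finally show ?case .
  qed
  from this[of n] have "f (h 0 {}) = (\<Oplus>\<^bsub>N\<^esub>S\<in>Pow {..<n}. f (h n S))"
    by simp
  moreover have "h 0 {} = map2 (\<oplus>\<^bsub>M\<^esub>) xs us"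
    by (rule nth_equalityI) (simp_all add: h_def len)
  moreover have "h n S = mix S xs us" for S
    by (rule nth_equalityI) (simp_all add: h_def mix_def len)
  ultimately show ?thesis by simp
qed

text \<open>If the strictly mixed summands vanish, the sets \<open>S\<close> that remain are the empty and the full
  one, the singletons and the complements of singletons. The latter two families are kept in one
  index set because they coincide for \<open>n = 2\<close>.\<close>

lemma expand_sum_near_pure:
  assumes "xs \<in> tuples n M" "us \<in> tuples n M" "2 \<le> n"
    and mixed: "\<And>S. S \<subseteq> {..<n} \<Longrightarrow> 2 \<le> card S \<Longrightarrow> card S + 2 \<le> n \<Longrightarrow> f (mix S xs us) = \<zero>\<^bsub>N\<^esub>"
  shows "f (map2 (\<oplus>\<^bsub>M\<^esub>) xs us) = f xs \<oplus>\<^bsub>N\<^esub>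
    (\<Oplus>\<^bsub>N\<^esub>S\<in>(\<lambda>i. {i}) ` {..<n} \<union> (\<lambda>i. {..<n} - {i}) ` {..<n}. f (mix S xs us)) \<oplus>\<^bsub>N\<^esub> f us"
proof -
  let ?I = "(\<lambda>i. {i}) ` {..<n} \<union> (\<lambda>i. {..<n} - {i}) ` {..<n}"
  let ?F = "\<lambda>S. f (mix S xs us)"
  have len: "length xs = n" "length us = n"
    using assms(1,2) by (auto simp: tuples_def)
  have closed': "?F S \<in> carrier N" for S
    using assms(1,2) by (intro closed) (auto simp: mix_def tuples_def)
  have card: "card S \<in> {1, n - 1}" if "S \<in> ?I" for S
    using that by auto
  have notin: "{} \<notin> ?I" "{..<n} \<notin> ?I" "{..<n} \<noteq> {}"
    using card[of "{}"] card[of "{..<n}"] assms(3) by (auto simp: lessThan_empty_iff)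
  then have notin': "{} \<notin> insert {..<n} ?I"
    by (metis insert_iff)
  have other: "?F S = \<zero>\<^bsub>N\<^esub>" if S: "S \<in> Pow {..<n} - insert {} (insert {..<n} ?I)" for S
  proof (rule mixed)
    show sub: "S \<subseteq> {..<n}" using S by auto
    then have fin: "finite S" by (rule finite_subset) simp
    have "card S \<noteq> 0" using S fin by auto
    moreover have "card S \<noteq> 1" using S by (auto simp: card_1_singleton_iff)
    ultimately show "2 \<le> card S" by simp
    have c: "card ({..<n} - S) = n - card S"
      using sub fin by (simp add: card_Diff_subset)
    have "card ({..<n} - S) \<noteq> 0" using S by auto
    moreover have "card ({..<n} - S) \<noteq> 1"
    proof
      assume "card ({..<n} - S) = 1"
      then obtain i where i: "{..<n} - S = {i}" by (auto simp: card_1_singleton_iff)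
      then have "S = {..<n} - {i}" "i < n" using sub by auto
      then show False using S by auto
    qed
    ultimately show "card S + 2 \<le> n" using c by simp
  qed
  have "f (map2 (\<oplus>\<^bsub>M\<^esub>) xs us) = (\<Oplus>\<^bsub>N\<^esub>S\<in>Pow {..<n}. ?F S)"
    by (rule expand_sum[OF assms(1,2)])
  also have "\<dots> = (\<Oplus>\<^bsub>N\<^esub>S\<in>insert {} (insert {..<n} ?I). ?F S)"
    by (rule N.add.finprod_mono_neutral_cong_right) (auto simp: closed' other)
  also have "\<dots> = ?F {} \<oplus>\<^bsub>N\<^esub> (\<Oplus>\<^bsub>N\<^esub>S\<in>insert {..<n} ?I. ?F S)"
    by (rule N.finsum_insert[OF _ notin' Pi_I[OF closed'] closed']) simp
  also have "(\<Oplus>\<^bsub>N\<^esub>S\<in>insert {..<n} ?I. ?F S) = ?F {..<n} \<oplus>\<^bsub>N\<^esub> (\<Oplus>\<^bsub>N\<^esub>S\<in>?I. ?F S)"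
    by (rule N.finsum_insert[OF _ notin(2) Pi_I[OF closed'] closed']) simp
  also have "mix {} xs us = xs"
    by (rule nth_equalityI) (simp_all add: mix_def)
  also have "mix {..<n} xs us = us"
    by (rule nth_equalityI) (simp_all add: mix_def len)
  finally show ?thesis
    using assms(1,2) closed' by (simp add: closed N.a_ac)
qed

text \<open>For \<open>n \<ge> 3\<close> singletons and their complements have different cardinalities \<open>1 < n - 1\<close>.\<close>

lemma expand_sum_extreme:
  assumes "xs \<in> tuples n M" "us \<in> tuples n M" "3 \<le> n"
    and mixed: "\<And>S. S \<subseteq> {..<n} \<Longrightarrow> 2 \<le> card S \<Longrightarrow> card S + 2 \<le> n \<Longrightarrow> f (mix S xs us) = \<zero>\<^bsub>N\<^esub>"
  shows "f (map2 (\<oplus>\<^bsub>M\<^esub>) xs us) = f xs \<oplus>\<^bsub>N\<^esub> (\<Oplus>\<^bsub>N\<^esub>i\<in>{..<n}. f (xs[i := us ! i])) \<oplus>\<^bsub>N\<^esub>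
    (\<Oplus>\<^bsub>N\<^esub>i\<in>{..<n}. f (us[i := xs ! i])) \<oplus>\<^bsub>N\<^esub> f us"
proof -
  let ?F = "\<lambda>S. f (mix S xs us)"
  have closed': "?F S \<in> carrier N" for S
    using assms(1,2) by (intro closed) (auto simp: mix_def tuples_def)
  have len: "length xs = n" "length us = n"
    using assms(1,2) by (auto simp: tuples_def)
  have mix_co: "mix ({..<n} - {i}) xs us = us[i := xs ! i]" for i
    using mix_co_singleton[of us xs i] by (simp only: len)
  have inj: "inj_on (\<lambda>i. {..<n} - {i}) {..<n}"
    by (auto simp: inj_on_def)
  have disj: "(\<lambda>i. {i}) ` {..<n} \<inter> (\<lambda>i. {..<n} - {i}) ` {..<n} = {}"
  proof -
    have "card {i} \<noteq> card ({..<n} - {j})" if "j < n" for i j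
      using that assms(3) by simp
    then show ?thesis
      by (metis (no_types, lifting) disjoint_iff imageE lessThan_iff)
  qed
  have "(\<Oplus>\<^bsub>N\<^esub>S\<in>(\<lambda>i. {i}) ` {..<n} \<union> (\<lambda>i. {..<n} - {i}) ` {..<n}. ?F S) =
      (\<Oplus>\<^bsub>N\<^esub>i\<in>{..<n}. ?F {i}) \<oplus>\<^bsub>N\<^esub> (\<Oplus>\<^bsub>N\<^esub>i\<in>{..<n}. ?F ({..<n} - {i}))"
    unfolding N.finsum_Un_disjoint[OF finite_imageI finite_imageI disj Pi_I[OF closed'] Pi_I[OF closed'],
        OF finite_lessThan finite_lessThan]
    by (simp add: N.finsum_reindex[OF Pi_I[OF closed'] inj] N.finsum_reindex[OF Pi_I[OF closed']])
  then have "(\<Oplus>\<^bsub>N\<^esub>S\<in>(\<lambda>i. {i}) ` {..<n} \<union> (\<lambda>i. {..<n} - {i}) ` {..<n}. ?F S) =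
      (\<Oplus>\<^bsub>N\<^esub>i\<in>{..<n}. f (xs[i := us ! i])) \<oplus>\<^bsub>N\<^esub> (\<Oplus>\<^bsub>N\<^esub>i\<in>{..<n}. f (us[i := xs ! i]))"
    by (simp only: mix_singleton mix_co)
  moreover have "f (xs[i := us ! i]) \<in> carrier N" "f (us[i := xs ! i]) \<in> carrier N" for i
    using closed'[of "{i}"] closed'[of "{..<n} - {i}"] by (simp_all only: mix_singleton mix_co)
  moreover have "2 \<le> n" using assms(3) by simp
  note expand_sum_near_pure[OF assms(1,2) this mixed]
  ultimately show ?thesis
    using closed[OF assms(1)] closed[OF assms(2)] by (simp add: N.a_assoc Pi_I)
qed

text \<open>For \<open>n = 2\<close> a singleton is the complement of the other one, so one family suffices, and no
  summand is strictly mixed.\<close>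

lemma expand_sum_binary:
  assumes "xs \<in> tuples n M" "us \<in> tuples n M" "n = 2"
  shows "f (map2 (\<oplus>\<^bsub>M\<^esub>) xs us) =
    f xs \<oplus>\<^bsub>N\<^esub> (\<Oplus>\<^bsub>N\<^esub>i\<in>{..<n}. f (us[i := xs ! i])) \<oplus>\<^bsub>N\<^esub> f us"
proof -
  let ?F = "\<lambda>S. f (mix S xs us)"
  have closed': "?F S \<in> carrier N" for S
    using assms(1,2) by (intro closed) (auto simp: mix_def tuples_def)
  have len: "length xs = n" "length us = n"
    using assms(1,2) by (auto simp: tuples_def)
  have mix_co: "mix ({..<n} - {i}) xs us = us[i := xs ! i]" for i
    using mix_co_singleton[of us xs i] by (simp only: len)
  have inj: "inj_on (\<lambda>i. {..<n} - {i}) {..<n}"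
    by (auto simp: inj_on_def)
  have "{..<n} = {0, 1}"
    using assms(3) by auto
  then have I: "(\<lambda>i. {i}) ` {..<n} \<union> (\<lambda>i. {..<n} - {i}) ` {..<n} = (\<lambda>i. {..<n} - {i}) ` {..<n}"
    by auto
  have "(\<Oplus>\<^bsub>N\<^esub>S\<in>(\<lambda>i. {..<n} - {i}) ` {..<n}. ?F S) = (\<Oplus>\<^bsub>N\<^esub>i\<in>{..<n}. f (us[i := xs ! i]))"
    by (simp only: N.finsum_reindex[OF Pi_I[OF closed'] inj] mix_co)
  moreover have "f (mix S xs us) = \<zero>\<^bsub>N\<^esub>" if "2 \<le> card S" "card S + 2 \<le> n" for S
    using that assms(3) by simp
  note expand_sum_near_pure[OF assms(1,2) _ this, unfolded I]
  ultimately show ?thesis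
    using assms(3) by simp
qed

end

section \<open>Alternating maps with values in spaces of linear maps\<close>

lemma linear_map_to_alternating_iff:
  "linear_map_to_alternating K N k M P \<theta> \<longleftrightarrow> alternating_map_to_Hom K k M N P (\<lambda>xs y. \<theta> y xs)"
  by (auto simp: linear_map_to_alternating_def alternating_map_to_Hom_def)

lemma alternating_map_to_Hom_zero:
  assumes "alternating_map_to_Hom K k M N P \<rho>" "module K M" "module K N" "module K P"
    and "xs \<in> tuples k M" "y \<in> carrier N" "y = \<zero>\<^bsub>N\<^esub> \<or> \<zero>\<^bsub>M\<^esub> \<in> set xs"
  shows "\<rho> xs y = \<zero>\<^bsub>P\<^esub>"
proof (cases "y = \<zero>\<^bsub>N\<^esub>")
  case True
  then show ?thesis
    using assms linear_map_zero[OF assms(3,4)] by (auto simp: alternating_map_to_Hom_def)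
next
  case False
  have "alternating_map K k M P (\<lambda>xs. \<rho> xs y)"
    using assms(1,6) by (simp add: alternating_map_to_Hom_def)
  then have "alternating K M P k (\<lambda>xs. \<rho> xs y)"
    by (intro alternating.intro assms alternating_axioms.intro)
  with assms(5,7) False show ?thesis
    using alternating.zero_entry by fastforce
qed

lemma alternating_map_const_zero_to_Hom:
  assumes "module K P"
  shows "alternating_map_to_Hom K k M N P (\<lambda>_ _. \<zero>\<^bsub>P\<^esub>)"
  using linear_map_const_zero[OF assms] alternating_map_const_zero[OF assms]
  by (auto simp: alternating_map_to_Hom_def)

lemma (in alternating) curry_last:
  assumes "0 < n" "linear_map K H M (\<lambda>x. x)" "linear_map K H' M (\<lambda>x. x)"
  shows "alternating_map_to_Hom K (n - 1) H H' N (\<lambda>xs y. f (xs @ [y]))"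
  unfolding alternating_map_to_Hom_def
proof (intro conjI ballI)
  fix xs assume xs: "xs \<in> tuples (n - 1) H"
  then have "xs @ [\<zero>\<^bsub>M\<^esub>] \<in> tuples n M" and len: "length xs = n - 1"
    using assms(1) linear_map_closed[OF assms(2)] by (auto simp: tuples_def)
  then have "linear_map K M N (\<lambda>y. f ((xs @ [\<zero>\<^bsub>M\<^esub>])[n - 1 := y]))"
    using assms(1) by (intro alternating_map_linear[OF alternating_map]) simp_all
  then have "linear_map K M N (\<lambda>y. f (xs @ [y]))"
    by (simp add: list_update_append len)
  from linear_map_compose[OF assms(3) this] show "linear_map K H' N (\<lambda>y. f (xs @ [y]))" .
next
  fix y assume "y \<in> carrier H'"
  then have y: "y \<in> carrier M" by (rule linear_map_closed[OF assms(3)])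
  have "alternating_map K (Suc (n - 1)) M N f"
    using alternating_map assms(1) by simp
  from alternating_map_precompose[OF alternating_map_snoc[OF this y] assms(2)]
  show "alternating_map K (n - 1) H N (\<lambda>xs. f (xs @ [y]))" by simp
qed

lemma (in alternating) curry_first:
  assumes "0 < n" "linear_map K H M (\<lambda>x. x)" "linear_map K H' M (\<lambda>x. x)"
  shows "linear_map_to_alternating K H' (n - 1) H N (\<lambda>y xs. f (y # xs))"
  unfolding linear_map_to_alternating_def
proof (intro conjI ballI)
  fix xs assume xs: "xs \<in> tuples (n - 1) H"
  then have "\<zero>\<^bsub>M\<^esub> # xs \<in> tuples n M"
    using assms(1) linear_map_closed[OF assms(2)] by (auto simp: tuples_def)
  from alternating_map_linear[OF alternating_map this assms(1)]
  have "linear_map K M N (\<lambda>y. f (y # xs))" by simp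
  from linear_map_compose[OF assms(3) this] show "linear_map K H' N (\<lambda>y. f (y # xs))" .
next
  fix y assume "y \<in> carrier H'"
  then have y: "y \<in> carrier M" by (rule linear_map_closed[OF assms(3)])
  have "alternating_map K (Suc (n - 1)) M N f"
    using alternating_map assms(1) by simp
  from alternating_map_precompose[OF alternating_map_Cons[OF this y] assms(2)]
  show "alternating_map K (n - 1) H N (\<lambda>xs. f (y # xs))" by simp
qed

section \<open>Brackets and subalgebras\<close>

text \<open>Here \<open>\<psi>\<close> is the inverse of an isomorphism \<open>\<phi>\<close> of vector spaces, and \<open>b'\<close> is \<open>b\<close> pulled back along
  \<open>\<phi>\<close>. The equation for \<open>b'\<close> is only required on tuples over the carrier, so that it applies to
  brackets given by a formula of their own.\<close>

lemma n_lie_bracket_transport: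
  assumes "module K D" "module K L" "is_n_lie_bracket K n L b" "0 < n"
    and lin: "linear_map K D L \<phi>" "linear_map K L D \<psi>"
    and inv: "\<And>y. y \<in> carrier L \<Longrightarrow> \<phi> (\<psi> y) = y"
    and b': "\<And>xs. xs \<in> tuples n D \<Longrightarrow> b' xs = \<psi> (b (map \<phi> xs))"
  shows "is_n_lie_bracket K n D b'"
proof -
  interpret D: module K D by fact
  interpret L: module K L by fact
  have alt: "alternating_map K n L L b"
    and jacobi: "\<And>zs ws. zs \<in> tuples (n - 1) L \<Longrightarrow> ws \<in> tuples n L \<Longrightarrow>
      b (zs @ [b ws]) = (\<Oplus>\<^bsub>L\<^esub>i\<in>{..<n}. b (ws[i := b (zs @ [ws ! i])]))"
    using assms(3) by (auto simp: is_n_lie_bracket_def)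
  have b_closed: "b xs \<in> carrier L" if "xs \<in> tuples n L" for xs
    using alt that by (auto simp: alternating_map_def)
  have tup: "map \<phi> xs \<in> tuples k L" if "xs \<in> tuples k D" for xs k
    using that linear_map_closed[OF lin(1)] by (auto simp: tuples_def)
  have snoc: "zs @ [x] \<in> tuples n M" if "zs \<in> tuples (n - 1) M" "x \<in> carrier M"
    for zs x and M :: "('x, 'y) partial_object_scheme"
    using that assms(4) by (auto simp: tuples_def)
  have nth: "ws ! i \<in> carrier M" if "ws \<in> tuples n M" "i < n"
    for ws i and M :: "('x, 'y) partial_object_scheme"
    using that by (auto simp: tuples_def)
  have b'_closed: "b' xs \<in> carrier D" if "xs \<in> tuples n D" for xs
    using that by (simp add: b' linear_map_closed[OF lin(2)] b_closed tup)
  have \<phi>_b': "\<phi> (b' xs) = b (map \<phi> xs)" if "xs \<in> tuples n D" for xs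
    using that by (simp add: b' inv b_closed tup)
  have alt': "alternating_map K n D D (\<lambda>xs. \<psi> (b (map \<phi> xs)))"
    by (intro alternating_map_compose[OF _ lin(2)] alternating_map_precompose[OF alt lin(1)])
      unfold_locales
  have "alternating_map K n D D b'"
    unfolding alternating_map_def
  proof (intro conjI ballI allI impI)
    fix xs i assume "xs \<in> tuples n D" "i < n"
    then show "linear_map K D D (\<lambda>x. b' (xs[i := x]))"
      by (intro linear_map_cong[OF alternating_map_linear[OF alt']])
        (auto simp: b' update_in_tuples assms(1))
  next
    fix xs i j assume "xs \<in> tuples n D" "i < j \<and> j < n \<and> xs ! i = xs ! j"
    then show "b' xs = \<zero>\<^bsub>D\<^esub>"
      using alt' unfolding alternating_map_def by (metis b')
  qed (use b'_closed in blast)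
  moreover have "b' (zs @ [b' ws]) = (\<Oplus>\<^bsub>D\<^esub>i\<in>{..<n}. b' (ws[i := b' (zs @ [ws ! i])]))"
    if zs: "zs \<in> tuples (n - 1) D" and ws: "ws \<in> tuples n D" for zs ws
  proof -
    let ?zs = "map \<phi> zs" and ?ws = "map \<phi> ws"
    let ?s = "\<lambda>i. b (?ws[i := b (?zs @ [?ws ! i])])"
    have s: "?s \<in> {..<n} \<rightarrow> carrier L"
      using ws by (intro Pi_I b_closed update_in_tuples snoc tup zs nth) auto
    have summand: "\<psi> (?s i) = b' (ws[i := b' (zs @ [ws ! i])])" if "i < n" for i
    proof -
      have 1: "zs @ [ws ! i] \<in> tuples n D"
        by (rule snoc[OF zs nth[OF ws that]])
      then have "b' (ws[i := b' (zs @ [ws ! i])]) = \<psi> (b (?ws[i := \<phi> (b' (zs @ [ws ! i]))]))"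
        by (simp only: b'[OF update_in_tuples[OF ws b'_closed]] map_update)
      also have "\<phi> (b' (zs @ [ws ! i])) = b (?zs @ [?ws ! i])"
        using that ws by (simp add: \<phi>_b'[OF 1] tuples_def)
      finally show ?thesis ..
    qed
    have "b' (zs @ [b' ws]) = \<psi> (b (?zs @ [b ?ws]))"
      by (simp add: b'[OF snoc[OF zs b'_closed[OF ws]]] \<phi>_b'[OF ws])
    also have "\<dots> = \<psi> (\<Oplus>\<^bsub>L\<^esub>i\<in>{..<n}. ?s i)"
      by (simp only: jacobi[OF tup[OF zs] tup[OF ws]])
    also have "\<dots> = (\<Oplus>\<^bsub>D\<^esub>i\<in>{..<n}. \<psi> (?s i))"
      by (rule linear_map_finsum[OF assms(2,1) lin(2) _ s]) simp
    also have "\<dots> = (\<Oplus>\<^bsub>D\<^esub>i\<in>{..<n}. b' (ws[i := b' (zs @ [ws ! i])]))"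
      by (rule D.add.finprod_cong')
        (use ws zs in \<open>auto simp: summand intro!: b'_closed update_in_tuples snoc nth\<close>)
    finally show ?thesis .
  qed
  ultimately show ?thesis
    by (simp add: is_n_lie_bracket_def)
qed

lemma n_lie_subalgebra_inclusion:
  assumes "n_lie_subalgebra K n H L"
  shows "linear_map K H L (\<lambda>x. x)"
proof (rule linear_mapI)
  have sub: "submodule (carrier H) K L"
    using assms by (simp add: n_lie_subalgebra_def)
  show "x \<in> carrier L" if "x \<in> carrier H" for x
    using subgroup.subset[OF submodule.axioms(1)[OF sub]] that by auto
qed (use assms in \<open>auto simp: n_lie_subalgebra_def\<close>)

lemma n_lie_subalgebraI:
  assumes "n_lie_algebra K n H" "module K L" "linear_map K H L (\<lambda>x. x)"
    and "\<And>xs. xs \<in> tuples n H \<Longrightarrow> bracket H xs = bracket L xs"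
  shows "n_lie_subalgebra K n H L"
proof -
  interpret H: n_lie_algebra K n H by fact
  interpret L: module K L by fact
  note incl = linear_map_closed[OF assms(3)] linear_map_add[OF assms(3)]
    linear_map_smult[OF assms(3)] linear_map_zero[OF H.module_axioms assms(2,3)]
  have minus: "\<ominus>\<^bsub>L\<^esub> a = \<ominus>\<^bsub>H\<^esub> a" if "a \<in> carrier H" for a
    using that incl(1)[of a] incl(1)[of "\<ominus>\<^bsub>H\<^esub> a"] incl(2)[of "\<ominus>\<^bsub>H\<^esub> a" a] incl(4) H.l_neg[of a]
    by (intro L.minus_equality) auto
  have "submodule (carrier H) K L"
    using incl by (intro L.submoduleI)
      (auto simp: minus incl(2,3)[symmetric] incl(4)[symmetric])
  moreover have "bracket H xs \<in> carrier H" if "xs \<in> tuples n H" for xs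
    using H.n_lie_bracket that by (auto simp: is_n_lie_bracket_def alternating_map_def)
  ultimately show ?thesis
    using assms(4) incl by (simp add: n_lie_subalgebra_def)
qed

lemma n_lie_algebra_alternating:
  assumes "n_lie_algebra K n L"
  shows "alternating K L L n (bracket L)"
proof -
  interpret n_lie_algebra K n L by fact
  show ?thesis
    using n_lie_bracket module_axioms
    by (intro alternating.intro alternating_axioms.intro) (auto simp: is_n_lie_bracket_def)
qed

lemma direct_sum_simps [simp]:
  "carrier (direct_sum M N) = carrier M \<times> carrier N"
  "\<zero>\<^bsub>direct_sum M N\<^esub> = (\<zero>\<^bsub>M\<^esub>, \<zero>\<^bsub>N\<^esub>)"
  "(x, u) \<oplus>\<^bsub>direct_sum M N\<^esub> (y, v) = (x \<oplus>\<^bsub>M\<^esub> y, u \<oplus>\<^bsub>N\<^esub> v)"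
  "a \<odot>\<^bsub>direct_sum M N\<^esub> (x, u) = (a \<odot>\<^bsub>M\<^esub> x, a \<odot>\<^bsub>N\<^esub> u)"
  by (simp_all add: direct_sum_def)

lemma bowtie_simps [simp]:
  "carrier (bowtie K n g V \<rho>\<^sub>g \<rho>\<^sub>V \<theta>\<^sub>V \<theta>\<^sub>g) = carrier g \<times> carrier V"
  "zero (bowtie K n g V \<rho>\<^sub>g \<rho>\<^sub>V \<theta>\<^sub>V \<theta>\<^sub>g) = (\<zero>\<^bsub>g\<^esub>, \<zero>\<^bsub>V\<^esub>)"
  "add (bowtie K n g V \<rho>\<^sub>g \<rho>\<^sub>V \<theta>\<^sub>V \<theta>\<^sub>g) = add (direct_sum g V)"
  "smult (bowtie K n g V \<rho>\<^sub>g \<rho>\<^sub>V \<theta>\<^sub>V \<theta>\<^sub>g) = smult (direct_sum g V)"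
  "bracket (bowtie K n g V \<rho>\<^sub>g \<rho>\<^sub>V \<theta>\<^sub>V \<theta>\<^sub>g) = bowtie_bracket K n g V \<rho>\<^sub>g \<rho>\<^sub>V \<theta>\<^sub>V \<theta>\<^sub>g"
  by (simp_all add: bowtie_def module.defs direct_sum_def)

section \<open>Bicrossed products factorize extremely\<close>

lemma nth_mem_omit: "j < length xs \<Longrightarrow> j \<noteq> i \<Longrightarrow> xs ! j \<in> set (omit i xs)"
proof (cases "j < i")
  case True
  then show "xs ! j \<in> set (omit i xs)" if "j < length xs"
    using that by (auto simp: omit_def in_set_conv_nth intro!: exI[of _ j])
next
  case False
  then show "xs ! j \<in> set (omit i xs)" if "j < length xs" "j \<noteq> i"
    using that by (auto simp: omit_def in_set_conv_nth intro!: disjI2 exI[of _ "j - Suc i"])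
qed

lemma mem_omit_replicate: "2 \<le> n \<Longrightarrow> z \<in> set (omit i (replicate n z))"
  using nth_mem_omit[of "if i = 0 then 1 else 0" "replicate n z" i] by (auto split: if_splits)

lemma omit_in_tuples: "xs \<in> tuples n M \<Longrightarrow> i < n \<Longrightarrow> omit i xs \<in> tuples (n - 1) M"
  by (auto simp: tuples_def omit_def dest: in_set_takeD in_set_dropD)

lemma nth_in_carrier: "xs \<in> tuples n M \<Longrightarrow> i < n \<Longrightarrow> xs ! i \<in> carrier M"
  by (auto simp: tuples_def)

text \<open>Each mixed summand of the bracket applies one of the four maps to an entry of one tuple and the
  other tuple with an entry omitted; it vanishes as soon as a zero is among these arguments. This
  covers tuples in \<open>g\<close>, tuples in \<open>V\<close>, and the tuples in the condition of extremality.\<close>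

lemma bowtie_bracket_no_mixed_terms:
  assumes g: "n_lie_algebra K n g" and V: "n_lie_algebra K n V"
    and pair: "extreme_matched_pair K n g V \<rho>\<^sub>g \<rho>\<^sub>V \<theta>\<^sub>V \<theta>\<^sub>g"
    and xs: "xs \<in> tuples n g" and us: "us \<in> tuples n V"
    and zero_u: "\<And>i. i < n \<Longrightarrow> us ! i = \<zero>\<^bsub>V\<^esub> \<or> \<zero>\<^bsub>g\<^esub> \<in> set (omit i xs)"
    and zero_x: "\<And>i. i < n \<Longrightarrow> xs ! i = \<zero>\<^bsub>g\<^esub> \<or> \<zero>\<^bsub>V\<^esub> \<in> set (omit i us)"
  shows "bowtie_bracket K n g V \<rho>\<^sub>g \<rho>\<^sub>V \<theta>\<^sub>V \<theta>\<^sub>g (zip xs us) = (bracket g xs, bracket V us)"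
proof -
  interpret g: n_lie_algebra K n g by fact
  interpret V: n_lie_algebra K n V by fact
  interpret bg: alternating K g g n "bracket g" by (rule n_lie_algebra_alternating[OF g])
  interpret bV: alternating K V V n "bracket V" by (rule n_lie_algebra_alternating[OF V])
  note hom = pair[unfolded extreme_matched_pair_def linear_map_to_alternating_iff]
  have summand: "\<rho>\<^sub>g (omit i xs) (us ! i) = \<zero>\<^bsub>V\<^esub>" "\<rho>\<^sub>V (omit i us) (xs ! i) = \<zero>\<^bsub>g\<^esub>"
    "\<theta>\<^sub>V (us ! i) (omit i xs) = \<zero>\<^bsub>g\<^esub>" "\<theta>\<^sub>g (xs ! i) (omit i us) = \<zero>\<^bsub>V\<^esub>" if "i < n" for i
    using alternating_map_to_Hom_zero[OF conjunct1[OF hom] g.module_axioms V.module_axioms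
        V.module_axioms omit_in_tuples[OF xs that] nth_in_carrier[OF us that] zero_u[OF that]]
      alternating_map_to_Hom_zero[OF conjunct1[OF conjunct2[OF hom]] V.module_axioms g.module_axioms
        g.module_axioms omit_in_tuples[OF us that] nth_in_carrier[OF xs that] zero_x[OF that]]
      alternating_map_to_Hom_zero[OF conjunct1[OF conjunct2[OF conjunct2[OF hom]]]
        g.module_axioms V.module_axioms g.module_axioms
        omit_in_tuples[OF xs that] nth_in_carrier[OF us that] zero_u[OF that]]
      alternating_map_to_Hom_zero[OF conjunct1[OF conjunct2[OF conjunct2[OF conjunct2[OF hom]]]]
        V.module_axioms g.module_axioms V.module_axioms
        omit_in_tuples[OF us that] nth_in_carrier[OF xs that] zero_x[OF that]]
    by simp_all
  have unzip: "map fst (zip xs us) = xs" "map snd (zip xs us) = us"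
    using xs us by (simp_all add: tuples_def)
  have sums: "(\<Oplus>\<^bsub>g\<^esub>i\<in>{..<n}. signed K g i (\<theta>\<^sub>V (us ! i) (omit i xs))) = \<zero>\<^bsub>g\<^esub>"
    "(\<Oplus>\<^bsub>g\<^esub>i\<in>{..<n}. signed K g (n - Suc i) (\<rho>\<^sub>V (omit i us) (xs ! i))) = \<zero>\<^bsub>g\<^esub>"
    "(\<Oplus>\<^bsub>V\<^esub>i\<in>{..<n}. signed K V (n - Suc i) (\<rho>\<^sub>g (omit i xs) (us ! i))) = \<zero>\<^bsub>V\<^esub>"
    "(\<Oplus>\<^bsub>V\<^esub>i\<in>{..<n}. signed K V (n - Suc i) (\<theta>\<^sub>g (xs ! i) (omit i us))) = \<zero>\<^bsub>V\<^esub>"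
    by (intro g.M.add.finprod_one_eqI V.M.add.finprod_one_eqI; simp add: summand)+
  show ?thesis
    using bg.closed[OF xs] bV.closed[OF us]
    by (simp only: bowtie_bracket_def Let_def unzip sums g.M.r_zero V.M.r_zero)
qed

text \<open>An isomorphism \<open>\<phi>\<close> fixing both factors is forced to be \<open>(x, u) \<mapsto> x + u\<close>; the properties of a
  factorization are then read off in \<open>g \<bowtie> V\<close>, where \<open>x\<close> is \<open>(x, 0)\<close> and \<open>u\<close> is \<open>(0, u)\<close>.\<close>

lemma bowtie_iso_imp_factorizes_extremely:
  assumes n: "2 \<le> n" and g: "n_lie_algebra K n g" and V: "n_lie_algebra K n V"
    and E: "n_lie_algebra K n E"
    and pair: "extreme_matched_pair K n g V \<rho>\<^sub>g \<rho>\<^sub>V \<theta>\<^sub>V \<theta>\<^sub>g"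
    and iso: "\<phi> \<in> n_lie_iso K n (bowtie K n g V \<rho>\<^sub>g \<rho>\<^sub>V \<theta>\<^sub>V \<theta>\<^sub>g) E"
    and \<phi>_g: "\<And>x. x \<in> carrier g \<Longrightarrow> \<phi> (x, \<zero>\<^bsub>V\<^esub>) = x"
    and \<phi>_V: "\<And>u. u \<in> carrier V \<Longrightarrow> \<phi> (\<zero>\<^bsub>g\<^esub>, u) = u"
  shows "factorizes_extremely K n E g V"
proof -
  let ?B = "bowtie K n g V \<rho>\<^sub>g \<rho>\<^sub>V \<theta>\<^sub>V \<theta>\<^sub>g"
  interpret g: n_lie_algebra K n g by fact
  interpret V: n_lie_algebra K n V by fact
  interpret E: n_lie_algebra K n E by fact
  interpret B: n_lie_algebra K n ?B by (rule bowtie_n_lie_algebra[OF g V pair])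
  interpret bg: alternating K g g n "bracket g" by (rule n_lie_algebra_alternating[OF g])
  interpret bV: alternating K V V n "bracket V" by (rule n_lie_algebra_alternating[OF V])
  have lin: "linear_map K ?B E \<phi>" and bij: "bij_betw \<phi> (carrier g \<times> carrier V) (carrier E)"
    and br: "\<And>ps. ps \<in> tuples n ?B \<Longrightarrow>
      \<phi> (bowtie_bracket K n g V \<rho>\<^sub>g \<rho>\<^sub>V \<theta>\<^sub>V \<theta>\<^sub>g ps) = bracket E (map \<phi> ps)"
    using iso by (simp_all add: n_lie_iso_def)
  have zero: "\<zero>\<^bsub>g\<^esub> = \<zero>\<^bsub>E\<^esub>" "\<zero>\<^bsub>V\<^esub> = \<zero>\<^bsub>E\<^esub>"
    using linear_map_zero[OF B.module_axioms E.module_axioms lin] \<phi>_g[OF g.M.zero_closed]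
      \<phi>_V[OF V.M.zero_closed] by simp_all
  have "linear_map K g ?B (\<lambda>x. (x, \<zero>\<^bsub>V\<^esub>))" "linear_map K V ?B (\<lambda>u. (\<zero>\<^bsub>g\<^esub>, u))"
    by (auto intro!: linear_mapI)
  from this[THEN linear_map_compose, OF lin]
  have incl_g: "linear_map K g E (\<lambda>x. x)" and incl_V: "linear_map K V E (\<lambda>u. u)"
    using linear_map_cong[of K g E "\<lambda>x. \<phi> (x, \<zero>\<^bsub>V\<^esub>)"] linear_map_cong[of K V E "\<lambda>u. \<phi> (\<zero>\<^bsub>g\<^esub>, u)"]
      \<phi>_g \<phi>_V g.module_axioms V.module_axioms by auto
  have \<phi>_pair: "\<phi> (x, u) = x \<oplus>\<^bsub>E\<^esub> u" if "x \<in> carrier g" "u \<in> carrier V" for x u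
    using linear_map_add[OF lin, of "(x, \<zero>\<^bsub>V\<^esub>)" "(\<zero>\<^bsub>g\<^esub>, u)"] that \<phi>_g \<phi>_V by simp
  have tup: "zip xs us \<in> tuples n ?B" if "xs \<in> tuples n g" "us \<in> tuples n V" for xs us
    using that by (auto simp: tuples_def dest: set_zip_leftD set_zip_rightD)
  have zeros: "replicate k \<zero>\<^bsub>V\<^esub> \<in> tuples k V" "replicate k \<zero>\<^bsub>g\<^esub> \<in> tuples k g" for k
    by (auto simp: tuples_def)
  have "bracket g xs = bracket E xs" if xs: "xs \<in> tuples n g" for xs
  proof -
    let ?ps = "zip xs (replicate n \<zero>\<^bsub>V\<^esub>)"
    have "map \<phi> ?ps = xs"
      using xs \<phi>_g nth_in_carrier[OF xs] by (intro nth_equalityI) (simp_all add: tuples_def)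
    then have "bracket E xs = \<phi> (bowtie_bracket K n g V \<rho>\<^sub>g \<rho>\<^sub>V \<theta>\<^sub>V \<theta>\<^sub>g ?ps)"
      using br[OF tup[OF xs zeros(1)]] by simp
    also have "\<dots> = \<phi> (bracket g xs, bracket V (replicate n \<zero>\<^bsub>V\<^esub>))"
      by (subst bowtie_bracket_no_mixed_terms[OF g V pair xs zeros(1)]) (simp_all add: mem_omit_replicate n)
    also have "\<dots> = bracket g xs"
      using n bg.closed[OF xs] bV.zero_entry[OF zeros(1)] \<phi>_g by simp
    finally show ?thesis ..
  qed
  from n_lie_subalgebraI[OF g E.module_axioms incl_g this]
  have sub_g: "n_lie_subalgebra K n g E" .
  have "bracket V us = bracket E us" if us: "us \<in> tuples n V" for us
  proof -
    let ?ps = "zip (replicate n \<zero>\<^bsub>g\<^esub>) us"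
    have "map \<phi> ?ps = us"
      using us \<phi>_V nth_in_carrier[OF us] by (intro nth_equalityI) (simp_all add: tuples_def)
    then have "bracket E us = \<phi> (bowtie_bracket K n g V \<rho>\<^sub>g \<rho>\<^sub>V \<theta>\<^sub>V \<theta>\<^sub>g ?ps)"
      using br[OF tup[OF zeros(2) us]] by simp
    also have "\<dots> = \<phi> (bracket g (replicate n \<zero>\<^bsub>g\<^esub>), bracket V us)"
      by (subst bowtie_bracket_no_mixed_terms[OF g V pair zeros(2) us]) (simp_all add: mem_omit_replicate n)
    also have "\<dots> = bracket V us"
      using n bV.closed[OF us] bg.zero_entry[OF zeros(2)] \<phi>_V by simp
    finally show ?thesis ..
  qed
  from n_lie_subalgebraI[OF V E.module_axioms incl_V this]
  have sub_V: "n_lie_subalgebra K n V E" .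
  have sum: "carrier g <+>\<^bsub>E\<^esub> carrier V = carrier E"
  proof -
    have "carrier E = \<phi> ` (carrier g \<times> carrier V)"
      using bij by (simp add: bij_betw_def)
    also have "\<dots> = (\<lambda>(x, u). x \<oplus>\<^bsub>E\<^esub> u) ` (carrier g \<times> carrier V)"
      by (rule image_cong) (auto simp: \<phi>_pair)
    finally show ?thesis
      by (auto simp: set_add_def' image_iff)
  qed
  have int: "carrier g \<inter> carrier V = {\<zero>\<^bsub>E\<^esub>}"
  proof (intro equalityI subsetI)
    fix x assume "x \<in> carrier g \<inter> carrier V"
    then have x: "x \<in> carrier g" "x \<in> carrier V" by auto
    then have "\<phi> (x, \<zero>\<^bsub>V\<^esub>) = \<phi> (\<zero>\<^bsub>g\<^esub>, x)" by (simp add: \<phi>_g \<phi>_V)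
    then have "(x, \<zero>\<^bsub>V\<^esub>) = (\<zero>\<^bsub>g\<^esub>, x)"
      by (rule inj_onD[OF bij_betw_imp_inj_on[OF bij]]) (use x in simp_all)
    then have "x = \<zero>\<^bsub>g\<^esub>" by (elim Pair_inject)
    then show "x \<in> {\<zero>\<^bsub>E\<^esub>}" by (simp only: zero(1) singletonI)
  qed (use g.M.zero_closed V.M.zero_closed in \<open>simp add: zero\<close>)
  have "bracket E (us @ xs) = \<zero>\<^bsub>E\<^esub>"
    if k: "2 \<le> k" "k + 2 \<le> n" and us: "us \<in> tuples k V" and xs: "xs \<in> tuples (n - k) g" for k us xs
  proof -
    \<comment> \<open>at least two zeros on either side: one of them survives the omission of any entry\<close>
    let ?xs = "replicate k \<zero>\<^bsub>g\<^esub> @ xs" and ?us = "us @ replicate (n - k) \<zero>\<^bsub>V\<^esub>"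
    have len: "length us = k" "length xs = n - k"
      using us xs by (auto simp: tuples_def)
    have t: "?xs \<in> tuples n g" "?us \<in> tuples n V"
      using k us xs by (auto simp: tuples_def)
    have "\<zero>\<^bsub>g\<^esub> \<in> set (omit i ?xs)" for i
      using nth_mem_omit[of 0 ?xs i] nth_mem_omit[of 1 ?xs i] k
      by (cases "i = 0") (simp_all add: nth_append)
    moreover have "\<zero>\<^bsub>V\<^esub> \<in> set (omit i ?us)" for i
      using nth_mem_omit[of k ?us i] nth_mem_omit[of "Suc k" ?us i] k len
      by (cases "i = k") (simp_all add: nth_append)
    ultimately have "bowtie_bracket K n g V \<rho>\<^sub>g \<rho>\<^sub>V \<theta>\<^sub>V \<theta>\<^sub>g (zip ?xs ?us) =
        (bracket g ?xs, bracket V ?us)"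
      by (intro bowtie_bracket_no_mixed_terms[OF g V pair t]) simp_all
    also have "\<dots> = (\<zero>\<^bsub>g\<^esub>, \<zero>\<^bsub>V\<^esub>)"
      using k by (simp add: bg.zero_entry[OF t(1)] bV.zero_entry[OF t(2)])
    finally have "bracket E (map \<phi> (zip ?xs ?us)) = \<phi> (\<zero>\<^bsub>g\<^esub>, \<zero>\<^bsub>V\<^esub>)"
      using br[OF tup[OF t]] by simp
    also have "\<dots> = \<zero>\<^bsub>E\<^esub>"
      using \<phi>_g[OF g.M.zero_closed] by (simp add: zero(1))
    also have "map \<phi> (zip ?xs ?us) = us @ xs"
      using us xs k \<phi>_g \<phi>_V by (intro nth_equalityI) (auto simp: tuples_def nth_append subset_iff)
    finally show ?thesis .
  qed
  then show ?thesis
    unfolding factorizes_extremely_def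
    by (intro conjI allI impI ballI sub_g sub_V sum int) (elim conjE)
qed

section \<open>Extreme factorizations are bicrossed products\<close>

text \<open>The matched pair consists of the components of the brackets in \<open>E\<close> of \<open>n - 1\<close> elements of one
  factor with one element of the other. Extremality says that these, together with the brackets
  inside the factors, determine the bracket of \<open>E\<close>, whose pullback to \<open>g \<oplus> V\<close> is therefore the
  bracket of \<open>g \<bowtie> V\<close>.\<close>

lemma factorizes_extremely_imp_bowtie_iso:
  fixes E g V :: "('k, 'v) n_lie"
  assumes n: "2 \<le> n" and g: "n_lie_algebra K n g" and V: "n_lie_algebra K n V"
    and E: "n_lie_algebra K n E"
    and fact: "factorizes_extremely K n E g V"
  obtains \<rho>\<^sub>g \<rho>\<^sub>V \<theta>\<^sub>V \<theta>\<^sub>g \<phi> where "extreme_matched_pair K n g V \<rho>\<^sub>g \<rho>\<^sub>V \<theta>\<^sub>V \<theta>\<^sub>g"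
    and "\<phi> \<in> n_lie_iso K n (bowtie K n g V \<rho>\<^sub>g \<rho>\<^sub>V \<theta>\<^sub>V \<theta>\<^sub>g) E"
    and "\<And>x. x \<in> carrier g \<Longrightarrow> \<phi> (x, \<zero>\<^bsub>V\<^esub>) = x"
    and "\<And>u. u \<in> carrier V \<Longrightarrow> \<phi> (\<zero>\<^bsub>g\<^esub>, u) = u"
proof -
  let ?D = "direct_sum g V"
  interpret g: n_lie_algebra K n g by fact
  interpret V: n_lie_algebra K n V by fact
  interpret E: n_lie_algebra K n E by fact
  interpret D: module K ?D by (rule direct_sum_module) unfold_locales
  interpret bE: alternating K E E n "bracket E" by (rule n_lie_algebra_alternating[OF E])
  have sub_g: "n_lie_subalgebra K n g E" and sub_V: "n_lie_subalgebra K n V E"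
    and sum: "carrier g <+>\<^bsub>E\<^esub> carrier V = carrier E"
    and int: "carrier g \<inter> carrier V = {\<zero>\<^bsub>E\<^esub>}"
    and extreme: "\<And>k us xs. 2 \<le> k \<Longrightarrow> k + 2 \<le> n \<Longrightarrow> us \<in> tuples k V \<Longrightarrow> xs \<in> tuples (n - k) g \<Longrightarrow>
      bracket E (us @ xs) = \<zero>\<^bsub>E\<^esub>"
    using fact by (auto simp: factorizes_extremely_def)
  note incl_g = n_lie_subalgebra_inclusion[OF sub_g] and incl_V = n_lie_subalgebra_inclusion[OF sub_V]
  note in_E = linear_map_closed[OF incl_g] linear_map_closed[OF incl_V]
  note sub = sub_g[unfolded n_lie_subalgebra_def] sub_V[unfolded n_lie_subalgebra_def]
  have zero: "\<zero>\<^bsub>g\<^esub> = \<zero>\<^bsub>E\<^esub>" "\<zero>\<^bsub>V\<^esub> = \<zero>\<^bsub>E\<^esub>"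
    using sub by simp_all
  have tuples_E: "xs \<in> tuples k E" if "xs \<in> tuples k g \<or> xs \<in> tuples k V" for k xs
    using that in_E by (auto simp: tuples_def)

  define \<phi> where "\<phi> = (\<lambda>(x, u). x \<oplus>\<^bsub>E\<^esub> u)"
  have \<phi>_lin: "linear_map K ?D E \<phi>"
    by (rule linear_mapI)
      (auto simp: \<phi>_def in_E linear_map_add[OF incl_g] linear_map_add[OF incl_V] E.M.a_ac
        linear_map_smult[OF incl_g] linear_map_smult[OF incl_V] E.smult_r_distr)
  have \<phi>_g: "\<phi> (x, \<zero>\<^bsub>V\<^esub>) = x" if "x \<in> carrier g" for x
    using that in_E by (simp add: \<phi>_def zero)
  have \<phi>_V: "\<phi> (\<zero>\<^bsub>g\<^esub>, u) = u" if "u \<in> carrier V" for u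
    using that in_E by (simp add: \<phi>_def zero)
  have inj: "inj_on \<phi> (carrier ?D)"
  proof (rule inj_onI, clarsimp simp: \<phi>_def)
    fix x u y v
    assume x: "x \<in> carrier g" and u: "u \<in> carrier V" and y: "y \<in> carrier g" and v: "v \<in> carrier V"
      and eq: "x \<oplus>\<^bsub>E\<^esub> u = y \<oplus>\<^bsub>E\<^esub> v"
    have "x \<ominus>\<^bsub>E\<^esub> y \<in> carrier g" "v \<ominus>\<^bsub>E\<^esub> u \<in> carrier V"
      using E.submoduleE(3,5)[of "carrier g"] E.submoduleE(3,5)[of "carrier V"] sub x u y v
      by (simp_all add: a_minus_def)
    moreover have "x \<ominus>\<^bsub>E\<^esub> y = v \<ominus>\<^bsub>E\<^esub> u"
    proof -
      note c = in_E(1)[OF x] in_E(2)[OF u] in_E(1)[OF y] in_E(2)[OF v]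
      have "v = (v \<oplus>\<^bsub>E\<^esub> y) \<oplus>\<^bsub>E\<^esub> \<ominus>\<^bsub>E\<^esub> y"
        using c by (simp add: E.M.a_assoc E.M.r_neg)
      also have "v \<oplus>\<^bsub>E\<^esub> y = x \<oplus>\<^bsub>E\<^esub> u"
        using c eq by (simp add: E.M.a_comm)
      also have "\<dots> \<oplus>\<^bsub>E\<^esub> \<ominus>\<^bsub>E\<^esub> y = (x \<ominus>\<^bsub>E\<^esub> y) \<oplus>\<^bsub>E\<^esub> u"
        using c by (simp add: a_minus_def E.M.a_ac)
      finally show ?thesis
        using c by (simp add: a_minus_def E.M.add.inv_solve_right)
    qed
    ultimately have "x \<ominus>\<^bsub>E\<^esub> y = \<zero>\<^bsub>E\<^esub>" "v \<ominus>\<^bsub>E\<^esub> u = \<zero>\<^bsub>E\<^esub>"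
      using int by auto
    moreover have "a = b" if "a \<in> carrier E" "b \<in> carrier E" "a \<ominus>\<^bsub>E\<^esub> b = \<zero>\<^bsub>E\<^esub>" for a b
      using that E.M.add.inv_solve_right[of "\<zero>\<^bsub>E\<^esub>" a b] by (simp add: a_minus_def)
    ultimately show "x = y \<and> u = v"
      using in_E(1)[OF x] in_E(2)[OF u] in_E(1)[OF y] in_E(2)[OF v] by metis
  qed
  have "carrier E = \<phi> ` carrier ?D"
    unfolding sum[symmetric] by (auto simp: \<phi>_def set_add_def' image_iff)
  with inj have bij: "bij_betw \<phi> (carrier ?D) (carrier E)"
    by (simp add: bij_betw_def)

  define \<psi> where "\<psi> = inv_into (carrier ?D) \<phi>"
  have \<psi>_lin: "linear_map K E ?D \<psi>"
    unfolding \<psi>_def by (rule linear_map_inv_into[OF D.module_axioms \<phi>_lin bij])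
  have \<phi>_\<psi>: "\<phi> (\<psi> e) = e" if "e \<in> carrier E" for e
    using bij that unfolding \<psi>_def by (metis bij_betw_inv_into_right)
  have \<psi>_\<phi>: "\<psi> (\<phi> p) = p" if "p \<in> carrier ?D" for p
    using inj that unfolding \<psi>_def by (rule inv_into_f_f)
  have \<psi>_g: "\<psi> x = (x, \<zero>\<^bsub>V\<^esub>)" if "x \<in> carrier g" for x
    using \<psi>_\<phi>[of "(x, \<zero>\<^bsub>V\<^esub>)"] that by (simp add: \<phi>_g)
  have \<psi>_V: "\<psi> u = (\<zero>\<^bsub>g\<^esub>, u)" if "u \<in> carrier V" for u
    using \<psi>_\<phi>[of "(\<zero>\<^bsub>g\<^esub>, u)"] that by (simp add: \<phi>_V)

  \<comment> \<open>the components of the bracket of \<open>E\<close> in \<open>g\<close> and in \<open>V\<close>, as alternating maps on \<open>E\<close>\<close>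
  define F where "F = (\<lambda>ws. fst (\<psi> (bracket E ws)))"
  define G where "G = (\<lambda>ws. snd (\<psi> (bracket E ws)))"
  have "linear_map K ?D g fst" "linear_map K ?D V snd"
    by (auto intro!: linear_mapI)
  then have "linear_map K E g (\<lambda>e. fst (\<psi> e))" "linear_map K E V (\<lambda>e. snd (\<psi> e))"
    using linear_map_compose[OF \<psi>_lin] by blast+
  from this[THEN alternating_map_compose[OF bE.alternating_map]]
  have "alternating_map K n E g F" "alternating_map K n E V G"
    unfolding F_def G_def by (simp_all add: E.module_axioms g.module_axioms V.module_axioms)
  then interpret F: alternating K E g n F + G: alternating K E V n G
    by unfold_locales
  have F_g: "F xs = bracket g xs" and G_g: "G xs = \<zero>\<^bsub>V\<^esub>" if "xs \<in> tuples n g" for xs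
    using sub that \<psi>_g by (auto simp: F_def G_def)
  have F_V: "F us = \<zero>\<^bsub>g\<^esub>" and G_V: "G us = bracket V us" if "us \<in> tuples n V" for us
    using sub that \<psi>_V by (auto simp: F_def G_def)
  have mixed: "F (mix S xs us) = \<zero>\<^bsub>g\<^esub> \<and> G (mix S xs us) = \<zero>\<^bsub>V\<^esub>"
    if xs: "xs \<in> tuples n g" and us: "us \<in> tuples n V"
      and S: "S \<subseteq> {..<n}" "2 \<le> card S" "card S + 2 \<le> n" for S xs us
  proof -
    \<comment> \<open>extremality speaks of tuples with the entries in \<open>V\<close> first; sort the mixed tuple accordingly\<close>
    let ?us = "map ((!) us) (filter (\<lambda>j. j \<in> S) [0..<n])"
    let ?xs = "map ((!) xs) (filter (\<lambda>j. j \<notin> S) [0..<n])"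
    have len: "length xs = n" "length us = n"
      using xs us by (auto simp: tuples_def)
    have card: "length (filter (\<lambda>j. j \<in> S) [0..<n]) = card S"
    proof -
      have "set (filter (\<lambda>j. j \<in> S) [0..<n]) = S"
        using S(1) by auto
      then show ?thesis
        using distinct_card[of "filter (\<lambda>j. j \<in> S) [0..<n]"] by simp
    qed
    have "length (filter (\<lambda>j. j \<notin> S) [0..<n]) = n - card S"
      using sum_length_filter_compl[of "\<lambda>j. j \<in> S" "[0..<n]"] card by simp
    then have "?us \<in> tuples (card S) V" "?xs \<in> tuples (n - card S) g"
      using xs us card by (auto simp: tuples_def)
    then have zero': "bracket E (?us @ ?xs) = \<zero>\<^bsub>E\<^esub>"
      by (rule extreme[OF S(2,3)])
    let ?h = "\<lambda>j. if j \<in> S then us ! j else xs ! j"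
    have "?us = map ?h (filter (\<lambda>j. j \<in> S) [0..<n])" "?xs = map ?h (filter (\<lambda>j. j \<notin> S) [0..<n])"
      by simp_all
    then have "mset (?us @ ?xs) = image_mset ?h
        (mset (filter (\<lambda>j. j \<in> S) [0..<n]) + mset (filter (\<lambda>j. j \<notin> S) [0..<n]))"
      by (simp only: mset_append mset_map image_mset_union)
    also have "\<dots> = image_mset ?h (mset [0..<n])"
      by (simp only: mset_filter multiset_partition[symmetric])
    finally have "mset (mix S xs us) = mset (?us @ ?xs)"
      by (simp only: mix_def len mset_map)
    moreover have "mix S xs us \<in> tuples n E"
      using nth_in_carrier[OF tuples_E[OF disjI1[OF xs]]] nth_in_carrier[OF tuples_E[OF disjI2[OF us]]]
      by (auto simp: mix_def tuples_def len)
    ultimately have "bracket E (mix S xs us) = \<zero>\<^bsub>E\<^esub>"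
      using bE.zero_permute[of "[]" "mix S xs us" "?us @ ?xs"] zero' by simp
    then show ?thesis
      using \<psi>_g[OF g.M.zero_closed] by (simp add: F_def G_def zero)
  qed

  \<comment> \<open>For \<open>n = 2\<close> a bracket of \<open>x\<close> and \<open>u\<close> is both of type \<open>(n - 1, 1)\<close> and of type \<open>(1, n - 1)\<close>;
    without the two zeros it would be counted twice, by \<open>\<rho>\<^sub>V\<close> and \<open>\<theta>\<^sub>V\<close> in \<open>g\<close> and by \<open>\<rho>\<^sub>g\<close> and \<open>\<theta>\<^sub>g\<close>
    in \<open>V\<close>.\<close>
  define \<rho>\<^sub>g where "\<rho>\<^sub>g = (\<lambda>xs u. G (xs @ [u]))"
  define \<rho>\<^sub>V where "\<rho>\<^sub>V = (\<lambda>us x. F (us @ [x]))"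
  define \<theta>\<^sub>V where "\<theta>\<^sub>V = (\<lambda>u xs. if n = 2 then \<zero>\<^bsub>g\<^esub> else F (u # xs))"
  define \<theta>\<^sub>g where "\<theta>\<^sub>g = (\<lambda>x us. if n = 2 then \<zero>\<^bsub>V\<^esub> else G (us @ [x]))"
  let ?b = "bowtie_bracket K n g V \<rho>\<^sub>g \<rho>\<^sub>V \<theta>\<^sub>V \<theta>\<^sub>g"
  have b: "?b ps = \<psi> (bracket E (map \<phi> ps))" if "ps \<in> tuples n ?D" for ps
  proof -
    let ?xs = "map fst ps" and ?us = "map snd ps"
    have xs: "?xs \<in> tuples n g" and us: "?us \<in> tuples n V"
      using that by (auto simp: tuples_def)
    note xsE = tuples_E[OF disjI1[OF xs]] and usE = tuples_E[OF disjI2[OF us]]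
    have nth: "?xs ! i \<in> carrier E" "?us ! i \<in> carrier E" if "i < n" for i
      using nth_in_carrier[OF xsE that] nth_in_carrier[OF usE that] .
    have map_\<phi>: "map \<phi> ps = map2 (\<oplus>\<^bsub>E\<^esub>) ?xs ?us" "map \<phi> ps = map2 (\<oplus>\<^bsub>E\<^esub>) ?us ?xs"
    proof -
      show "map \<phi> ps = map2 (\<oplus>\<^bsub>E\<^esub>) ?xs ?us"
        by (rule nth_equalityI) (auto simp: \<phi>_def split: prod.splits)
      also have "\<dots> = map2 (\<oplus>\<^bsub>E\<^esub>) ?us ?xs"
      proof (rule nth_equalityI)
        fix i assume "i < length (map2 (\<oplus>\<^bsub>E\<^esub>) ?xs ?us)"
        then have i: "i < length ps" "i < n" using that by (simp_all add: tuples_def)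
        have "map2 (\<oplus>\<^bsub>E\<^esub>) ?xs ?us ! i = ?xs ! i \<oplus>\<^bsub>E\<^esub> ?us ! i"
          using i(1) by (simp add: case_prod_beta)
        also have "\<dots> = ?us ! i \<oplus>\<^bsub>E\<^esub> ?xs ! i"
          by (rule E.M.a_comm[OF nth[OF i(2)]])
        also have "\<dots> = map2 (\<oplus>\<^bsub>E\<^esub>) ?us ?xs ! i"
          using i(1) by (simp add: case_prod_beta)
        finally show "map2 (\<oplus>\<^bsub>E\<^esub>) ?xs ?us ! i = map2 (\<oplus>\<^bsub>E\<^esub>) ?us ?xs ! i" .
      qed simp
      finally show "map \<phi> ps = map2 (\<oplus>\<^bsub>E\<^esub>) ?us ?xs" .
    qed
    have F_upd: "F (?us[i := ?xs ! i]) = signed K g (n - Suc i) (\<rho>\<^sub>V (omit i ?us) (?xs ! i))"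
      "n \<noteq> 2 \<Longrightarrow> F (?xs[i := ?us ! i]) = signed K g i (\<theta>\<^sub>V (?us ! i) (omit i ?xs))"
      and G_upd: "G (?xs[i := ?us ! i]) = signed K V (n - Suc i) (\<rho>\<^sub>g (omit i ?xs) (?us ! i))"
      "n \<noteq> 2 \<Longrightarrow> G (?us[i := ?xs ! i]) = signed K V (n - Suc i) (\<theta>\<^sub>g (?xs ! i) (omit i ?us))"
      if "i < n" for i
      using F.update_eq_omit_snoc[OF usE nth(1)[OF that] that]
        F.update_eq_Cons_omit[OF xsE nth(2)[OF that] that]
        G.update_eq_omit_snoc[OF xsE nth(2)[OF that] that]
        G.update_eq_omit_snoc[OF usE nth(1)[OF that] that]
      by (simp_all only: \<rho>\<^sub>V_def \<rho>\<^sub>g_def \<theta>\<^sub>V_def \<theta>\<^sub>g_def if_False)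
    have F_sum: "(\<Oplus>\<^bsub>g\<^esub>i\<in>{..<n}. F (?us[i := ?xs ! i])) =
        (\<Oplus>\<^bsub>g\<^esub>i\<in>{..<n}. signed K g (n - Suc i) (\<rho>\<^sub>V (omit i ?us) (?xs ! i)))"
      "n \<noteq> 2 \<Longrightarrow> (\<Oplus>\<^bsub>g\<^esub>i\<in>{..<n}. F (?xs[i := ?us ! i])) =
        (\<Oplus>\<^bsub>g\<^esub>i\<in>{..<n}. signed K g i (\<theta>\<^sub>V (?us ! i) (omit i ?xs)))"
      and G_sum: "(\<Oplus>\<^bsub>V\<^esub>i\<in>{..<n}. G (?xs[i := ?us ! i])) =
        (\<Oplus>\<^bsub>V\<^esub>i\<in>{..<n}. signed K V (n - Suc i) (\<rho>\<^sub>g (omit i ?xs) (?us ! i)))"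
      "n \<noteq> 2 \<Longrightarrow> (\<Oplus>\<^bsub>V\<^esub>i\<in>{..<n}. G (?us[i := ?xs ! i])) =
        (\<Oplus>\<^bsub>V\<^esub>i\<in>{..<n}. signed K V (n - Suc i) (\<theta>\<^sub>g (?xs ! i) (omit i ?us)))"
      using xsE usE nth
      by (auto intro!: g.M.add.finprod_cong'[OF refl, symmetric] V.M.add.finprod_cong'[OF refl, symmetric]
          F.closed G.closed update_in_tuples simp: F_upd[symmetric] G_upd[symmetric])
    have fst_b: "fst (?b ps) = bracket g ?xs \<oplus>\<^bsub>g\<^esub>
        (\<Oplus>\<^bsub>g\<^esub>i\<in>{..<n}. signed K g i (\<theta>\<^sub>V (?us ! i) (omit i ?xs))) \<oplus>\<^bsub>g\<^esub>
        (\<Oplus>\<^bsub>g\<^esub>i\<in>{..<n}. signed K g (n - Suc i) (\<rho>\<^sub>V (omit i ?us) (?xs ! i)))"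
      and snd_b: "snd (?b ps) = bracket V ?us \<oplus>\<^bsub>V\<^esub>
        (\<Oplus>\<^bsub>V\<^esub>i\<in>{..<n}. signed K V (n - Suc i) (\<rho>\<^sub>g (omit i ?xs) (?us ! i))) \<oplus>\<^bsub>V\<^esub>
        (\<Oplus>\<^bsub>V\<^esub>i\<in>{..<n}. signed K V (n - Suc i) (\<theta>\<^sub>g (?xs ! i) (omit i ?us)))"
      by (simp_all only: bowtie_bracket_def Let_def fst_conv snd_conv)
    have F_closed: "F ?xs \<in> carrier g" "(\<Oplus>\<^bsub>g\<^esub>i\<in>{..<n}. F (?us[i := ?xs ! i])) \<in> carrier g"
      "(\<Oplus>\<^bsub>g\<^esub>i\<in>{..<n}. F (?xs[i := ?us ! i])) \<in> carrier g"
      and G_closed: "G ?us \<in> carrier V" "(\<Oplus>\<^bsub>V\<^esub>i\<in>{..<n}. G (?us[i := ?xs ! i])) \<in> carrier V"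
      "(\<Oplus>\<^bsub>V\<^esub>i\<in>{..<n}. G (?xs[i := ?us ! i])) \<in> carrier V"
      using xsE usE nth
      by (auto intro!: g.M.finsum_closed V.M.finsum_closed F.closed G.closed update_in_tuples)
    have "F (map \<phi> ps) = fst (?b ps) \<and> G (map \<phi> ps) = snd (?b ps)"
    proof (cases "n = 2")
      case True
      have zero_sums: "(\<Oplus>\<^bsub>g\<^esub>i\<in>{..<n}. signed K g i (\<theta>\<^sub>V (?us ! i) (omit i ?xs))) = \<zero>\<^bsub>g\<^esub>"
        "(\<Oplus>\<^bsub>V\<^esub>i\<in>{..<n}. signed K V (n - Suc i) (\<theta>\<^sub>g (?xs ! i) (omit i ?us))) = \<zero>\<^bsub>V\<^esub>"
        by (intro g.M.add.finprod_one_eqI V.M.add.finprod_one_eqI; simp add: \<theta>\<^sub>V_def \<theta>\<^sub>g_def True)+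
      have "F (map \<phi> ps) = F ?xs \<oplus>\<^bsub>g\<^esub> (\<Oplus>\<^bsub>g\<^esub>i\<in>{..<n}. F (?us[i := ?xs ! i])) \<oplus>\<^bsub>g\<^esub> F ?us"
        unfolding map_\<phi>(1) by (rule F.expand_sum_binary[OF xsE usE True])
      \<comment> \<open>the roles of \<open>xs\<close> and \<open>us\<close> are exchanged because \<open>\<rho>\<^sub>g\<close> takes its single argument from \<open>V\<close>\<close>
      moreover have "G (map \<phi> ps) = G ?us \<oplus>\<^bsub>V\<^esub> (\<Oplus>\<^bsub>V\<^esub>i\<in>{..<n}. G (?xs[i := ?us ! i])) \<oplus>\<^bsub>V\<^esub> G ?xs"
        unfolding map_\<phi>(2) by (rule G.expand_sum_binary[OF usE xsE True])
      ultimately show ?thesis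
        using F_closed G_closed unfolding fst_b snd_b zero_sums F_sum(1) G_sum(1)
        by (simp add: F_g[OF xs] F_V[OF us] G_g[OF xs] G_V[OF us])
    next
      case False
      then have n3: "3 \<le> n" using n by simp
      have "F (map \<phi> ps) = F ?xs \<oplus>\<^bsub>g\<^esub> (\<Oplus>\<^bsub>g\<^esub>i\<in>{..<n}. F (?xs[i := ?us ! i])) \<oplus>\<^bsub>g\<^esub>
          (\<Oplus>\<^bsub>g\<^esub>i\<in>{..<n}. F (?us[i := ?xs ! i])) \<oplus>\<^bsub>g\<^esub> F ?us"
        unfolding map_\<phi>(1)
        by (rule F.expand_sum_extreme[OF xsE usE n3]) (use mixed[OF xs us] in blast)
      moreover have "G (map \<phi> ps) = G ?xs \<oplus>\<^bsub>V\<^esub> (\<Oplus>\<^bsub>V\<^esub>i\<in>{..<n}. G (?xs[i := ?us ! i])) \<oplus>\<^bsub>V\<^esub>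
          (\<Oplus>\<^bsub>V\<^esub>i\<in>{..<n}. G (?us[i := ?xs ! i])) \<oplus>\<^bsub>V\<^esub> G ?us"
        unfolding map_\<phi>(1)
        by (rule G.expand_sum_extreme[OF xsE usE n3]) (use mixed[OF xs us] in blast)
      ultimately show ?thesis
        using F_closed G_closed unfolding fst_b snd_b F_sum(1) F_sum(2)[OF False] G_sum(1)
          G_sum(2)[OF False]
        by (simp add: F_g[OF xs] F_V[OF us] G_g[OF xs] G_V[OF us] V.M.a_ac)
    qed
    then show ?thesis
      by (simp add: F_def G_def prod_eq_iff)
  qed
  have pos: "0 < n" using n by simp
  have "is_n_lie_bracket K n ?D ?b"
    by (rule n_lie_bracket_transport[OF D.module_axioms E.module_axioms E.n_lie_bracket pos
          \<phi>_lin \<psi>_lin \<phi>_\<psi> b])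
  moreover have "alternating_map_to_Hom K (n - 1) g V V \<rho>\<^sub>g"
    unfolding \<rho>\<^sub>g_def by (rule G.curry_last[OF pos incl_g incl_V])
  moreover have "alternating_map_to_Hom K (n - 1) V g g \<rho>\<^sub>V"
    unfolding \<rho>\<^sub>V_def by (rule F.curry_last[OF pos incl_V incl_g])
  moreover have "linear_map_to_alternating K V (n - 1) g g \<theta>\<^sub>V"
    using F.curry_first[OF pos incl_g incl_V] alternating_map_const_zero_to_Hom[OF g.module_axioms]
    by (cases "n = 2") (simp_all add: \<theta>\<^sub>V_def linear_map_to_alternating_iff)
  moreover have "linear_map_to_alternating K g (n - 1) V V \<theta>\<^sub>g"
    using G.curry_last[OF pos incl_V incl_g] alternating_map_const_zero_to_Hom[OF V.module_axioms]
    by (cases "n = 2") (simp_all add: \<theta>\<^sub>g_def linear_map_to_alternating_iff)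
  ultimately have pair: "extreme_matched_pair K n g V \<rho>\<^sub>g \<rho>\<^sub>V \<theta>\<^sub>V \<theta>\<^sub>g"
    by (simp add: extreme_matched_pair_def)
  have "\<phi> (?b ps) = bracket E (map \<phi> ps)" if "ps \<in> tuples n ?D" for ps
  proof -
    have "map \<phi> ps \<in> tuples n E"
      using that linear_map_closed[OF \<phi>_lin] by (auto simp: tuples_def)
    from \<phi>_\<psi>[OF bE.closed[OF this]] show ?thesis by (simp only: b[OF that])
  qed
  then have "\<phi> \<in> n_lie_iso K n (bowtie K n g V \<rho>\<^sub>g \<rho>\<^sub>V \<theta>\<^sub>V \<theta>\<^sub>g) E"
    using \<phi>_lin bij by (simp add: n_lie_iso_def linear_map_def hom_def tuples_def)
  from that[OF pair this \<phi>_g \<phi>_V] show ?thesis .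
qed

theorem theorem6p5:
  fixes K :: "('k, 'r) ring_scheme" and n :: nat
    and E g V :: "('k, 'v) n_lie"
  assumes "char_zero_field K" and "2 \<le> n"
    and "n_lie_algebra K n g" and "n_lie_algebra K n V" and "n_lie_algebra K n E"
  shows "factorizes_extremely K n E g V \<longleftrightarrow>
    (\<exists>\<rho>\<^sub>g \<rho>\<^sub>V \<theta>\<^sub>V \<theta>\<^sub>g. extreme_matched_pair K n g V \<rho>\<^sub>g \<rho>\<^sub>V \<theta>\<^sub>V \<theta>\<^sub>g \<and>
      (\<exists>\<phi> \<in> n_lie_iso K n (bowtie K n g V \<rho>\<^sub>g \<rho>\<^sub>V \<theta>\<^sub>V \<theta>\<^sub>g) E.
        (\<forall>x\<in>carrier g. \<phi> (x, \<zero>\<^bsub>V\<^esub>) = x) \<and> (\<forall>u\<in>carrier V. \<phi> (\<zero>\<^bsub>g\<^esub>, u) = u)))"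
    (is "?fact \<longleftrightarrow> ?iso")
proof
  assume ?fact
  from factorizes_extremely_imp_bowtie_iso[OF assms(2-5) this] show ?iso
    by metis
next
  assume ?iso
  then show ?fact
    using bowtie_iso_imp_factorizes_extremely[OF assms(2-5)] by blast
qed

end
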